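(* Let $q=p^r$ with $p$ an odd prime, $s=2$, $h\in\{0,1\}$, $m\ge2$, $a\in\mathbb{F}_q$, $t\mid m$, and assume $p\nmid m/t$ and $d\mid h$, where $d=\gcd(m/t,2)$. Let $\rho$ be the quadratic character of $\mathbb{F}_q$. Then: If $a=0$: $N_t=\frac12(q^{t-1}-1)$ when $m/t$ and $t$ are odd; $N_t=\frac12\bigl(q^{t-1}-1-(q-1)(-1)^hq^{(t-2)/2}\rho((-1)^{t/2})\bigr)$ when $m/t$ is odd and $t$ even; $N_t=q^{t-1}-1$ when $m/t$ is even. If $a\ne0$: $N_t=\frac12\bigl(q^{t-1}+(-1)^hq^{(t-1)/2}\rho\bigl((-1)^{(t-1)/2}\tfrac{m}{ta}\bigr)\bigr)$ when $m/t$ and $t$ are odd; $N_t=\frac12\bigl(q^{t-1}+(-1)^hq^{(t-2)/2}\rho((-1)^{t/2})\bigr)$ when $m/t$ is odd and $t$ even; $N_t=q^{t-1}$ when $m/t$ is even.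
   Context: $\mathrm{Tr}_m,\mathrm{Nm}_m$ are the trace and norm from $\mathbb{F}_{q^m}$ to $\mathbb{F}_q$; $\gamma_m$ is a fixed primitive element of $\mathbb{F}_{q^m}$ and $g=\mathrm{Nm}_m(\gamma_m)$ (a primitive element of $\mathbb{F}_q$). $N_t$ is the number of $x\in\mathbb{F}_{q^t}$ with $\mathrm{Tr}_m(x)=a$ and $\mathrm{Nm}_m(x)\in g^h\langle g^2\rangle$ (i.e. the norm is a square if $h=0$, a nonsquare if $h=1$). $\frac{m}{ta}$ denotes $(m/t)\cdot a^{-1}\in\mathbb{F}_q$. *)

theory Defs
  imports Complex_Main "HOL-Library.Cardinality" "HOL-Computational_Algebra.Primes"
begin

text \<open>
  The field with \<open>q ^ m\<close> elements is a type of class \<open>finite_field\<close>; its subfields with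
  \<open>q\<close> and \<open>q ^ t\<close> elements are subsets of that type, each determined uniquely by its
  cardinality.
\<close>

definition is_subfield :: "'a::field set \<Rightarrow> bool" where
  "is_subfield F \<longleftrightarrow>
     0 \<in> F \<and> 1 \<in> F \<and>
     (\<forall>x\<in>F. \<forall>y\<in>F. x - y \<in> F \<and> x * y \<in> F) \<and>
     (\<forall>x\<in>F. inverse x \<in> F)"

definition ff_trace :: "nat \<Rightarrow> nat \<Rightarrow> 'a::field \<Rightarrow> 'a" where
  "ff_trace q m x = (\<Sum>i<m. x ^ (q ^ i))"

definition ff_norm :: "nat \<Rightarrow> nat \<Rightarrow> 'a::field \<Rightarrow> 'a" where
  "ff_norm q m x = (\<Prod>i<m. x ^ (q ^ i))"

definition cyclic_group :: "'a::field \<Rightarrow> 'a set" where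
  "cyclic_group x = range (\<lambda>k::int. x powi k)"

definition primitive_element :: "'a::field \<Rightarrow> bool" where
  "primitive_element x \<longleftrightarrow> cyclic_group x = UNIV - {0}"

text \<open>
  Squares are taken inside the subfield \<open>F\<close>: every element of \<open>F\<close> may well be a square in the
  ambient field.
\<close>

definition quadratic_character :: "'a::field set \<Rightarrow> 'a \<Rightarrow> int" where
  "quadratic_character F x =
     (if x = 0 then 0 else if \<exists>y\<in>F. x = y ^ 2 then 1 else - 1)"

text \<open>
  Here \<open>Ft\<close> is the subfield with \<open>q ^ t\<close> elements, while trace and norm are those of the
  full extension of degree \<open>m\<close>; \<open>g\<close> is a primitive element of the field with \<open>q\<close> elements.
  The coset consists of nonzero elements only, so \<open>x = 0\<close> is never counted.
\<close>

definition trace_norm_count ::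
    "nat \<Rightarrow> nat \<Rightarrow> 'a::field set \<Rightarrow> 'a \<Rightarrow> 'a \<Rightarrow> nat \<Rightarrow> nat" where
  "trace_norm_count q m Ft a g h =
     card {x \<in> Ft. ff_trace q m x = a \<and>
                    ff_norm q m x \<in> (\<lambda>y. g ^ h * y) ` cyclic_group (g ^ 2)}"

end

(* Euler's criterion on the field with q^m elements turns the norm condition into a condition on its
   quadratic character, whose restriction to K = F_{q^t} is the (m/t)-th power of the character chi of K.
   So everything reduces to E(b) = sum of chi(x) over the x in K with trace b. If K = F(alpha) and f is
   the minimal polynomial of alpha, the quadratic form Q(y) = Tr(y^2 / f'(alpha)) represents b exactly
   q^(t-1) + chi(f'(alpha)) E(b) times. By Euler's formula, Tr(P(alpha) / f'(alpha)) is the coefficient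
   of X^(t-1) in P whenever deg P < t, so Q vanishes on polynomials of degree < (t-1)/2 and the
   representation numbers can be counted degree by degree, without diagonalising Q. Finally
   chi(f'(alpha)) is found from the norm of f'(alpha), up to sign the discriminant of f. *)

theory Submission
  imports Defs "HOL-Computational_Algebra.Polynomial" "HOL-Library.FuncSet"
begin

section \<open>Subfields and the quadratic character\<close>

text \<open>Euler's formula gives traces only for polynomials of degree below t, whereas P^2 can
  have degree up to 2t - 2, and the traces of higher degree depend on f. They never have to be
  known. If P has degree n with 2n >= t, the monomial X^j with j = t - 1 - n has smaller degree,
  satisfies Q(X^j) = 0, and pairs with P to the leading coefficient of P; translating P by multiples
  of X^j therefore spreads the values of Q evenly over F. Hence the difference between the numbers
  of representations of b and of 0 is frozen at about half the dimension, where Q is either zero (t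
  even) or the square of the middle coefficient (t odd). This is where the powers of q near q^(t/2)
  come from. Differences determine E only up to a constant, which the vanishing of the sum of E(b)
  over F supplies. All of this is integer counting, without Gauss sums. The remaining sign is
  delicate because the Vandermonde product of the conjugates lies in K but not always in F.\<close>

lemma is_subfieldD:
  assumes "is_subfield F"
  shows "0 \<in> F" "1 \<in> F" "\<And>x y. x \<in> F \<Longrightarrow> y \<in> F \<Longrightarrow> x - y \<in> F"
    "\<And>x y. x \<in> F \<Longrightarrow> y \<in> F \<Longrightarrow> x * y \<in> F" "\<And>x. x \<in> F \<Longrightarrow> inverse x \<in> F"
  using assms by (auto simp: is_subfield_def)

lemma is_subfield_uminus:
  assumes "is_subfield F" "x \<in> F"
  shows "- x \<in> F"
  using is_subfieldD(3)[OF assms(1), of 0 x] is_subfieldD(1)[OF assms(1)] assms(2) by simp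

lemma is_subfield_add:
  assumes "is_subfield F" "x \<in> F" "y \<in> F"
  shows "x + y \<in> F"
  using is_subfieldD(3)[OF assms(1), of x "- y"] is_subfield_uminus[OF assms(1)] assms(2,3) by simp

lemma is_subfield_divide:
  assumes "is_subfield F" "x \<in> F" "y \<in> F"
  shows "x / y \<in> F"
  using is_subfieldD[OF assms(1)] assms(2,3) by (simp add: divide_inverse)

lemma is_subfield_power:
  assumes "is_subfield F" "x \<in> F"
  shows "x ^ n \<in> F"
  using is_subfieldD[OF assms(1)] assms(2) by (induction n) auto

lemma is_subfield_sum:
  assumes "is_subfield F" "\<And>i. i \<in> A \<Longrightarrow> f i \<in> F"
  shows "(\<Sum>i\<in>A. f i) \<in> F"
  using assms(2)
  by (induction A rule: infinite_finite_induct)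
    (auto intro: is_subfield_add[OF assms(1)] is_subfieldD(1)[OF assms(1)])

lemma is_subfield_prod:
  assumes "is_subfield F" "\<And>i. i \<in> A \<Longrightarrow> f i \<in> F"
  shows "(\<Prod>i\<in>A. f i) \<in> F"
  using assms(2)
  by (induction A rule: infinite_finite_induct)
    (auto intro: is_subfieldD(4)[OF assms(1)] is_subfieldD(2)[OF assms(1)])

lemma is_subfield_of_nat:
  assumes "is_subfield F"
  shows "of_nat n \<in> F"
  using is_subfieldD[OF assms] is_subfield_add[OF assms] by (induction n) auto

lemmas is_subfield_intros =
  is_subfieldD(1-5) is_subfield_uminus is_subfield_add is_subfield_divide is_subfield_power
  is_subfield_sum is_subfield_prod is_subfield_of_nat

text \<open>Multiplication by x permutes the nonzero elements of F, so their product equals itself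
  times the power of x.\<close>

lemma subfield_power_card_minus_1:
  fixes F :: "'a::finite_field set"
  assumes F: "is_subfield F" and x: "x \<in> F" "x \<noteq> 0"
  shows "x ^ (card F - 1) = 1"
proof -
  have "(\<Prod>y\<in>F - {0}. x * y) = (\<Prod>y\<in>F - {0}. y)"
    by (rule prod.reindex_bij_witness[of _ "\<lambda>y. y / x" "\<lambda>y. x * y"])
      (use x is_subfield_intros[OF F] in auto)
  moreover have "(\<Prod>y\<in>F - {0}. x * y) = x ^ (card F - 1) * (\<Prod>y\<in>F - {0}. y)"
    using is_subfieldD(1)[OF F] by (simp add: prod.distrib)
  moreover have "(\<Prod>y\<in>F - {0}. y) \<noteq> 0"
    by simp
  ultimately show ?thesis
    by (metis mult_cancel_right1)
qed

lemma subfield_power_card: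
  fixes F :: "'a::finite_field set"
  assumes F: "is_subfield F" and x: "x \<in> F"
  shows "x ^ card F = x"
proof -
  have "card F > 0"
    using x by (auto simp: card_gt_0_iff)
  then show ?thesis
    using subfield_power_card_minus_1[OF assms] by (cases "x = 0") (auto simp: power_eq_if)
qed

lemma card_nth_roots_le:
  fixes c :: "'a::finite_field"
  assumes "n > 0"
  shows "card {x. x ^ n = c} \<le> n"
proof -
  let ?p = "monom 1 n + [:- c:]"
  have "degree ?p = n"
    by (subst degree_add_eq_left) (use assms in \<open>auto simp: degree_monom_eq\<close>)
  moreover from this assms have "?p \<noteq> 0"
    by auto
  ultimately have "card {x. poly ?p x = 0} \<le> n"
    by (metis card_poly_roots_bound)
  then show ?thesis
    by (simp add: poly_monom)
qed

lemma subfield_card_ge_2: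
  fixes F :: "'a::finite_field set"
  assumes F: "is_subfield F"
  shows "card F \<ge> 2"
proof -
  have "card {0, 1::'a} \<le> card F"
    using is_subfieldD(1,2)[OF F] by (intro card_mono) auto
  then show ?thesis
    by simp
qed

text \<open>X^n - X with n = \<open>card F\<close> has at most n roots, and F already supplies n.
  Membership in a subfield thereby becomes an equation between powers.\<close>

lemma subfield_eq_fixed_points:
  fixes F :: "'a::finite_field set"
  assumes F: "is_subfield F"
  shows "F = {x. x ^ card F = x}"
proof (rule card_subset_eq)
  let ?n = "card F" and ?p = "monom 1 (card F) + [:0, - (1::'a):]"
  show "F \<subseteq> {x::'a. x ^ ?n = x}"
    using subfield_power_card[OF F] by auto
  have "degree ?p = ?n"
    by (subst degree_add_eq_left) (use subfield_card_ge_2[OF F] in \<open>auto simp: degree_monom_eq\<close>)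
  moreover from this have "?p \<noteq> 0"
    using subfield_card_ge_2[OF F] by auto
  ultimately have "card {x. poly ?p x = 0} \<le> ?n"
    by (metis card_poly_roots_bound)
  moreover have "{x. poly ?p x = 0} = {x::'a. x ^ ?n = x}"
    by (simp add: poly_monom)
  ultimately have "card {x::'a. x ^ ?n = x} \<le> ?n"
    by simp
  moreover have "card F \<le> card {x::'a. x ^ ?n = x}"
    using \<open>F \<subseteq> {x::'a. x ^ ?n = x}\<close> by (intro card_mono) auto
  ultimately show "card F = card {x::'a. x ^ ?n = x}"
    by linarith
qed auto

lemma card_square_roots:
  fixes F :: "'a::finite_field set"
  assumes F: "is_subfield F" and two: "(2::'a) \<noteq> 0" and x: "x \<in> F"
  shows "int (card {y \<in> F. y ^ 2 = x}) = 1 + quadratic_character F x"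
proof (cases "x = 0")
  case True
  then have "{y \<in> F. y ^ 2 = x} = {0}"
    using is_subfieldD(1)[OF F] by auto
  then show ?thesis
    using True by (simp add: quadratic_character_def)
next
  case False
  show ?thesis
  proof (cases "\<exists>y\<in>F. x = y ^ 2")
    case True
    then obtain z where z: "z \<in> F" "x = z ^ 2"
      by blast
    have "{y \<in> F. y ^ 2 = x} = {z, - z}"
      using z is_subfield_uminus[OF F] by (auto simp: power2_eq_iff)
    moreover have "z \<noteq> - z"
    proof
      assume "z = - z"
      then have "z + z = 0"
        by (simp only: add_eq_0_iff)
      then have "2 * z = 0"
        by (simp only: mult_2)
      then show False
        using two z False by auto
    qed
    ultimately have "card {y \<in> F. y ^ 2 = x} = 2"
      by (simp only: card_2_iff) blast
    moreover have "quadratic_character F x = 1"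
      using True False by (simp add: quadratic_character_def)
    ultimately show ?thesis
      by (simp only:)
  next
    case neg: False
    then have "{y \<in> F. y ^ 2 = x} = {}"
      by blast
    moreover have "quadratic_character F x = - 1"
      using neg False by (simp add: quadratic_character_def)
    ultimately show ?thesis
      by (simp only: card.empty of_nat_0)
  qed
qed

text \<open>Group the y by their squares: the fibre over x has 1 + \<chi>(x) elements. This is the
  bridge between counting values at squares and character sums.\<close>

lemma sum_comp_square:
  fixes F :: "'a::finite_field set" and f :: "'a \<Rightarrow> int"
  assumes F: "is_subfield F" and two: "(2::'a) \<noteq> 0"
  shows "(\<Sum>y\<in>F. f (y ^ 2)) = (\<Sum>x\<in>F. (1 + quadratic_character F x) * f x)"
proof -
  have "(\<Sum>y\<in>F. f (y ^ 2)) = (\<Sum>x\<in>F. \<Sum>y\<in>{y \<in> F. y ^ 2 = x}. f (y ^ 2))"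
    by (rule sum.group[symmetric]) (auto intro: is_subfield_power[OF F])
  also have "\<dots> = (\<Sum>x\<in>F. (1 + quadratic_character F x) * f x)"
  proof (rule sum.cong)
    fix x assume "x \<in> F"
    have "(\<Sum>y\<in>{y \<in> F. y ^ 2 = x}. f (y ^ 2)) = (\<Sum>y\<in>{y \<in> F. y ^ 2 = x}. f x)"
      by (rule sum.cong) auto
    then show "(\<Sum>y\<in>{y \<in> F. y ^ 2 = x}. f (y ^ 2)) = (1 + quadratic_character F x) * f x"
      using card_square_roots[OF F two \<open>x \<in> F\<close>] by simp
  qed simp
  finally show ?thesis .
qed

lemma sum_quadratic_character:
  fixes F :: "'a::finite_field set"
  assumes F: "is_subfield F" and two: "(2::'a) \<noteq> 0"
  shows "(\<Sum>x\<in>F. quadratic_character F x) = 0"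
  using sum_comp_square[OF assms, of "\<lambda>_. 1"] by (simp add: sum.distrib)

lemma quadratic_character_0 [simp]: "quadratic_character F 0 = 0"
  by (simp add: quadratic_character_def)

lemma quadratic_character_eq_0_iff [simp]: "quadratic_character F x = 0 \<longleftrightarrow> x = 0"
  by (simp add: quadratic_character_def)

lemma quadratic_character_cases:
  assumes "x \<noteq> 0"
  obtains "quadratic_character F x = 1" | "quadratic_character F x = - 1"
  using assms by (cases "\<exists>y\<in>F. x = y ^ 2") (simp_all add: quadratic_character_def)

text \<open>Euler's criterion: the nonzero squares make up half of the roots of
  \<open>x ^ (n - 1) = 1\<close>, and they already exhaust the roots of \<open>x ^ ((n - 1) div 2) = 1\<close>.\<close>
lemma quadratic_character_eq_power:
  fixes F :: "'a::finite_field set"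
  assumes F: "is_subfield F" and two: "(2::'a) \<noteq> 0" and odd: "odd (card F)" and x: "x \<in> F"
  shows "of_int (quadratic_character F x) = x ^ ((card F - 1) div 2)"
proof -
  define k where "k = (card F - 1) div 2"
  have n: "card F - 1 = 2 * k" "k > 0"
    using odd subfield_card_ge_2[OF F] unfolding k_def by presburger+
  show ?thesis
  proof (cases "x = 0")
    case True
    then show ?thesis
      using n(2) by (simp add: k_def)
  next
    case False
    define S where "S = {z \<in> F - {0}. quadratic_character F z = 1}"
    \<comment> \<open>Since the character sums to zero, this total is \<open>card F\<close>; zero
      contributes 1 and each nonzero square 2, which leaves k nonzero squares.\<close>
    have "(\<Sum>z\<in>F. 1 + quadratic_character F z) = int (card F)"
      using sum_quadratic_character[OF F two] by (simp add: sum.distrib)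
    moreover have "(\<Sum>z\<in>F. 1 + quadratic_character F z)
        = 1 + (\<Sum>z\<in>F - {0}. 1 + quadratic_character F z)"
      by (subst sum.remove[of _ 0]) (auto intro: is_subfieldD(1)[OF F])
    moreover have "(\<Sum>z\<in>F - {0}. 1 + quadratic_character F z)
        = (\<Sum>z\<in>F - {0}. if quadratic_character F z = 1 then 2 else 0)"
      by (intro sum.cong refl) (auto simp: quadratic_character_def)
    moreover have "\<dots> = 2 * int (card S)"
      by (simp add: S_def sum.If_cases Int_def)
    ultimately have cS: "card S = k"
      using n by linarith
    have sub: "S \<subseteq> {z::'a. z ^ k = 1}"
    proof
      fix z assume z: "z \<in> S"
      then have "z \<noteq> 0" "\<exists>y\<in>F. z = y ^ 2"
        by (auto simp: S_def quadratic_character_def split: if_splits)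
      then obtain y where y: "y \<in> F" "z = y ^ 2" "y \<noteq> 0"
        by auto
      then have "z ^ k = y ^ (card F - 1)"
        by (simp only: n(1) power_mult)
      then show "z \<in> {z::'a. z ^ k = 1}"
        using subfield_power_card_minus_1[OF F] y by simp
    qed
    have "S = {z::'a. z ^ k = 1}"
    proof (rule card_subset_eq[OF _ sub])
      show "card S = card {z::'a. z ^ k = 1}"
        using card_mono[OF _ sub] card_nth_roots_le[OF n(2), of "1::'a"] cS
        by (intro antisym) auto
    qed auto
    then have iff: "quadratic_character F x = 1 \<longleftrightarrow> x ^ k = 1"
      using False x unfolding S_def by auto
    have "(x ^ k) ^ 2 = 1"
      using subfield_power_card_minus_1[OF F x False] unfolding n(1)
      by (metis power_mult mult.commute)
    then have "x ^ k = 1 \<or> x ^ k = - 1"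
      by (simp add: power2_eq_1_iff)
    then show ?thesis
      unfolding k_def[symmetric] using iff by (cases rule: quadratic_character_cases[OF False, of F]) auto
  qed
qed

lemma quadratic_character_sign:
  assumes "x \<noteq> 0"
  shows "quadratic_character F x \<in> {1, - 1}"
  using assms by (rule quadratic_character_cases) auto

text \<open>Euler's criterion gives identities inside the field. As 1 and -1 differ there,
  identities between signs lift back to any ring of signs, in particular to
  \<open>int\<close>.\<close>

lemma of_int_sign_eqD:
  assumes "(2::'a::ring_1) \<noteq> 0" "a \<in> {1, - 1}" "b \<in> {1, - 1}" "of_int a = (of_int b :: 'a)"
  shows "a = b"
proof -
  have one: "(1::'a) \<noteq> - 1"
    using assms(1) by (metis add.right_inverse one_add_one)
  show ?thesis
    using assms(2-4) one one[symmetric]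
    by (elim insertE emptyE) (simp_all only: of_int_1 of_int_minus simp_thms)
qed

lemma quadratic_character_mult:
  fixes F :: "'a::finite_field set"
  assumes F: "is_subfield F" "(2::'a) \<noteq> 0" "odd (card F)" and xy: "x \<in> F" "y \<in> F"
  shows "quadratic_character F (x * y) = quadratic_character F x * quadratic_character F y"
proof (cases "x = 0 \<or> y = 0")
  case False
  have "of_int (quadratic_character F (x * y))
      = (of_int (quadratic_character F x * quadratic_character F y) :: 'a)"
    using xy is_subfieldD(4)[OF F(1)] by (simp add: quadratic_character_eq_power[OF F] power_mult_distrib)
  moreover have "quadratic_character F (x * y) \<in> {1, - 1}"
    "quadratic_character F x * quadratic_character F y \<in> {1, - 1}"
    using quadratic_character_sign[of x F] quadratic_character_sign[of y F]
      quadratic_character_sign[of "x * y" F] False by auto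
  ultimately show ?thesis
    using of_int_sign_eqD[OF F(2)] by blast
qed (use quadratic_character_0 in \<open>auto simp del: quadratic_character_eq_0_iff\<close>)

lemma quadratic_character_inverse:
  fixes F :: "'a::finite_field set"
  assumes F: "is_subfield F" and x: "x \<in> F" "x \<noteq> 0"
  shows "quadratic_character F (inverse x) = quadratic_character F x"
proof -
  have "(\<exists>y\<in>F. inverse x = y ^ 2) \<longleftrightarrow> (\<exists>y\<in>F. x = y ^ 2)"
    by (metis F inverse_inverse_eq is_subfieldD(5) power_inverse)
  then show ?thesis
    using x by (simp add: quadratic_character_def)
qed

section \<open>Products of differences\<close>

text \<open>R is its own Lagrange interpolant \<open>L\<close> on C, since both have degree below
  \<open>card C\<close>. Each \<open>M x\<close> is monic of degree \<open>card C - 1\<close>, so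
  the claim compares the coefficients of that degree.\<close>

lemma sum_poly_div_prod_differences:
  fixes R :: "'a::field poly"
  assumes "finite C" and deg: "degree R < card C"
  shows "(\<Sum>x\<in>C. poly R x / (\<Prod>y\<in>C - {x}. x - y)) = coeff R (card C - 1)"
proof -
  define D where "D x = (\<Prod>y\<in>C - {x}. x - y)" for x
  define M where "M x = (\<Prod>y\<in>C - {x}. [:- y, 1:])" for x
  define L where "L = (\<Sum>x\<in>C. smult (poly R x / D x) (M x))"
  have degM: "degree (M x) = card C - 1" if "x \<in> C" for x
    unfolding M_def using that \<open>finite C\<close> by (subst degree_prod_eq_sum_degree) auto
  have leadM: "coeff (M x) (card C - 1) = 1" if "x \<in> C" for x
    using degM[OF that] unfolding M_def
    by (metis (no_types, lifting) lead_coeff_prod lead_coeff_pCons(1) one_neq_zero pCons_eq_0_iff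
        lead_coeff_1 prod.neutral_const one_pCons prod.cong degree_pCons_eq)
  have "R = L"
  proof (rule poly_eqI_degree[of C])
    fix z assume z: "z \<in> C"
    have "poly L z = (\<Sum>x\<in>C. poly R x / D x * poly (M x) z)"
      by (simp add: L_def poly_sum)
    also have "\<dots> = poly R z / D z * poly (M z) z"
    proof (subst sum.remove[OF \<open>finite C\<close> z])
      have "poly (M x) z = 0" if "x \<in> C - {z}" for x
        unfolding M_def poly_prod by (rule prod_zero) (use that z \<open>finite C\<close> in auto)
      then show "poly R z / D z * poly (M z) z + (\<Sum>x\<in>C - {z}. poly R x / D x * poly (M x) z)
          = poly R z / D z * poly (M z) z"
        by simp
    qed
    also have "poly (M z) z = D z"
      by (simp add: M_def D_def poly_prod)
    also have "poly R z / D z * D z = poly R z"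
      using \<open>finite C\<close> by (auto simp: D_def)
    finally show "poly R z = poly L z" by simp
  next
    have "degree L \<le> card C - 1"
      unfolding L_def
      by (rule degree_sum_le[OF \<open>finite C\<close>]) (use degM in \<open>auto intro: order_trans[OF degree_smult_le]\<close>)
    then show "degree L < card C"
      using deg by linarith
  qed (fact deg)
  then have "coeff R (card C - 1) = coeff L (card C - 1)"
    by simp
  also have "\<dots> = (\<Sum>x\<in>C. poly R x / D x)"
    by (simp add: L_def coeff_sum leadM[unfolded One_nat_def])
  finally show ?thesis
    by (simp add: D_def)
qed

text \<open>Each of the n (n - 1) / 2 unordered pairs occurs twice, with opposite signs. This is the
  usual passage from the discriminant to the Vandermonde product.\<close>

lemma prod_differences_eq_square:
  fixes a :: "nat \<Rightarrow> 'a::comm_ring_1"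
  shows "(\<Prod>j<n. \<Prod>i\<in>{..<n} - {j}. a j - a i)
    = (- 1) ^ (n * (n - 1) div 2) * (\<Prod>j<n. \<Prod>i<j. a j - a i) ^ 2"
proof (induction n)
  case (Suc n)
  have "(\<Prod>j<Suc n. \<Prod>i\<in>{..<Suc n} - {j}. a j - a i)
      = (\<Prod>j<n. \<Prod>i\<in>insert n ({..<n} - {j}). a j - a i) * (\<Prod>i<n. a n - a i)"
  proof -
    have "{..<Suc n} - {n} = {..<n}"
      by auto
    moreover have "{..<Suc n} - {j} = insert n ({..<n} - {j})" if "j < n" for j
      using that by auto
    ultimately show ?thesis
      by simp
  qed
  also have "(\<Prod>j<n. \<Prod>i\<in>insert n ({..<n} - {j}). a j - a i)
      = (\<Prod>j<n. - 1 * (a n - a j)) * (\<Prod>j<n. \<Prod>i\<in>{..<n} - {j}. a j - a i)"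
    by (simp add: prod.distrib)
  also have "(\<Prod>j<n. - 1 * (a n - a j)) = (- 1) ^ n * (\<Prod>i<n. a n - a i)"
    by (subst prod.distrib) simp
  finally have "(\<Prod>j<Suc n. \<Prod>i\<in>{..<Suc n} - {j}. a j - a i)
      = (- 1) ^ n * (\<Prod>i<n. a n - a i) * (\<Prod>j<n. \<Prod>i\<in>{..<n} - {j}. a j - a i) * (\<Prod>i<n. a n - a i)" .
  moreover have "Suc n * n = n * 2 + n * (n - 1)"
    by (cases n) auto
  then have "Suc n * (Suc n - 1) div 2 = n + n * (n - 1) div 2"
    by simp
  ultimately show ?case
    by (simp only: Suc.IH power_add power2_eq_square prod.lessThan_Suc mult_ac)
qed simp

text \<open>The shift of indices is an n-cycle, of sign (-1)^(n - 1): only the n - 1 pairs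
  containing the index n, which wraps around to 0, change their order.\<close>

lemma prod_differences_cyclic_shift:
  fixes a :: "nat \<Rightarrow> 'a::comm_ring_1"
  assumes "n > 0" "a n = a 0"
  shows "(\<Prod>j<n. \<Prod>i<j. a (Suc j) - a (Suc i)) = (- 1) ^ (n - 1) * (\<Prod>j<n. \<Prod>i<j. a j - a i)"
proof -
  obtain k where n: "n = Suc k"
    using assms(1) by (cases n) auto
  have "(\<Prod>j<Suc k. \<Prod>i<j. a j - a i) = (\<Prod>j<k. \<Prod>i<Suc j. a (Suc j) - a i)"
    by (subst prod.lessThan_Suc_shift) simp
  also have "\<dots> = (\<Prod>j<k. a (Suc j) - a 0) * (\<Prod>j<k. \<Prod>i<j. a (Suc j) - a (Suc i))"
    by (subst prod.lessThan_Suc_shift) (simp add: prod.distrib)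
  finally have V: "(\<Prod>j<Suc k. \<Prod>i<j. a j - a i)
      = (\<Prod>j<k. a (Suc j) - a 0) * (\<Prod>j<k. \<Prod>i<j. a (Suc j) - a (Suc i))" .
  have "(\<Prod>i<k. a (Suc k) - a (Suc i)) = (\<Prod>i<k. - 1 * (a (Suc i) - a 0))"
    using assms(2) n by simp
  also have "\<dots> = (- 1) ^ k * (\<Prod>i<k. a (Suc i) - a 0)"
    by (subst prod.distrib) simp
  finally show ?thesis
    unfolding n using V by (simp add: mult_ac)
qed

text \<open>Bounding coefficients instead of requiring \<open>degree P < n\<close> keeps the zero
  polynomial in the set when n = 0, so that the cardinality is uniformly
  \<open>card F ^ n\<close>.\<close>

definition polys_below :: "'a::zero set \<Rightarrow> nat \<Rightarrow> 'a poly set" where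
  "polys_below F n = {P. (\<forall>i. coeff P i \<in> F) \<and> (\<forall>i\<ge>n. coeff P i = 0)}"

lemma card_polys_below:
  assumes "finite F" "0 \<in> F"
  shows "finite (polys_below F n) \<and> card (polys_below F n) = card F ^ n"
proof (induction n)
  case 0
  have "polys_below F 0 = {0}"
    using assms(2) by (auto simp: polys_below_def intro: poly_eqI)
  then show ?case
    by simp
next
  case (Suc n)
  have eq: "polys_below F (Suc n) = (\<lambda>(c, P). pCons c P) ` (F \<times> polys_below F n)"
  proof (intro set_eqI iffI)
    fix P assume P: "P \<in> polys_below F (Suc n)"
    obtain c Q where Q: "P = pCons c Q"
      by (cases P)
    have "coeff Q i = coeff P (Suc i)" for i
      by (simp add: Q)
    moreover have "c = coeff P 0"
      by (simp add: Q)
    ultimately have "c \<in> F" "Q \<in> polys_below F n"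
      using P by (auto simp: polys_below_def)
    then show "P \<in> (\<lambda>(c, P). pCons c P) ` (F \<times> polys_below F n)"
      using Q by auto
  next
    fix P assume "P \<in> (\<lambda>(c, P). pCons c P) ` (F \<times> polys_below F n)"
    then show "P \<in> polys_below F (Suc n)"
      by (auto simp: polys_below_def coeff_pCons split: nat.splits)
  qed
  have "inj_on (\<lambda>(c, P). pCons c P) (F \<times> polys_below F n)"
    by (auto simp: inj_on_def)
  then show ?case
    using Suc.IH assms(1) unfolding eq by (simp add: card_image card_cartesian_product)
qed

section \<open>The trace of a simple extension\<close>

text \<open>\<open>inj_conjugates\<close> expresses that \<alpha> generates K over F: t distinct
  conjugates force degree t, and no minimal polynomial has to be introduced. \<open>q_CHAR\<close>
  makes the q-th power map additive.\<close>

locale field_tower =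
  fixes q t :: nat and F K :: "'a::finite_field set" and \<alpha> :: 'a
  assumes subfield_F: "is_subfield F" and subfield_K: "is_subfield K"
    and card_F: "card F = q" and card_K: "card K = q ^ t" and t_pos: "t > 0"
    and two: "(2::'a) \<noteq> 0" and odd_q: "odd q" and q_CHAR: "\<exists>r. q = CHAR('a) ^ r"
    and \<alpha>: "\<alpha> \<in> K" and inj_conjugates: "inj_on (\<lambda>i. \<alpha> ^ (q ^ i)) {..<t}"
begin

lemma q_ge_2: "q \<ge> 2"
  using subfield_card_ge_2[OF subfield_F] card_F by simp

lemma power_q_F: "x \<in> F \<longleftrightarrow> x ^ q = x"
  using subfield_eq_fixed_points[OF subfield_F] card_F by (metis (mono_tags) mem_Collect_eq)

lemma power_qi_F: "x \<in> F \<Longrightarrow> x ^ (q ^ i) = x"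
  using power_q_F[of x] by (induction i) (auto simp: power_mult)

lemma power_qt_K: "x \<in> K \<longleftrightarrow> x ^ (q ^ t) = x"
  using subfield_eq_fixed_points[OF subfield_K] card_K by (metis (mono_tags) mem_Collect_eq)

lemma F_subset_K: "F \<subseteq> K"
  using power_qi_F power_qt_K by blast

lemma frobenius_add: "(x + y) ^ (q ^ i) = x ^ (q ^ i) + (y::'a) ^ (q ^ i)"
  using q_CHAR freshmans_dream'[of "q ^ i" _ x y] CHAR_prime[where 'a = 'a]
  by (auto simp: power_mult[symmetric])

lemma frobenius_minus: "(x - y) ^ (q ^ i) = x ^ (q ^ i) - (y::'a) ^ (q ^ i)"
  using frobenius_add[of "x - y" y i] by simp

lemma frobenius_poly:
  assumes "\<And>i. coeff P i \<in> F"
  shows "poly P x ^ (q ^ j) = poly P (x ^ (q ^ j))"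
  using assms
proof (induction P)
  case 0
  then show ?case
    using q_ge_2 by (simp add: power_0_left)
next
  case (pCons c P)
  have "c \<in> F" "coeff P i \<in> F" for i
    using pCons.prems[of 0] pCons.prems[of "Suc i"] by auto
  then show ?case
    using pCons.IH by (simp add: frobenius_add power_qi_F power_mult_distrib)
qed

lemma ff_trace_add: "ff_trace q t (x + y) = ff_trace q t x + ff_trace q t (y::'a)"
  by (simp add: ff_trace_def frobenius_add sum.distrib)

lemma ff_trace_scale: "c \<in> F \<Longrightarrow> ff_trace q t (c * x) = c * ff_trace q t x"
  by (simp add: ff_trace_def power_mult_distrib power_qi_F sum_distrib_left)

lemma ff_trace_0 [simp]: "ff_trace q t (0::'a) = 0"
  using ff_trace_add[of 0 0] by (metis add_cancel_right_right)

lemma ff_trace_uminus: "ff_trace q t (- x) = - ff_trace q t (x::'a)"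
  using ff_trace_add[of "- x" x] by (simp add: eq_neg_iff_add_eq_0)

lemma ff_trace_diff: "ff_trace q t (x - y) = ff_trace q t x - ff_trace q t (y::'a)"
  using ff_trace_add[of x "- y"] by (simp add: ff_trace_uminus)

lemma frobenius_ff_trace: "ff_trace q t x ^ q = (\<Sum>i<t. (x::'a) ^ (q ^ Suc i))"
proof -
  have "(\<Sum>i\<in>A. f i) ^ q = (\<Sum>i\<in>A. f i ^ q)" if "finite A" for f :: "nat \<Rightarrow> 'a" and A
    using that
  proof induction
    case empty
    then show ?case
      using q_ge_2 by (simp add: power_0_left)
  next
    case (insert x A)
    then show ?case
      using frobenius_add[of _ _ 1] by simp
  qed
  then show ?thesis
    by (simp add: ff_trace_def power_mult[symmetric] mult.commute)
qed

lemma ff_trace_in_F: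
  assumes "x \<in> K"
  shows "ff_trace q t x \<in> F"
proof -
  \<comment> \<open>Both sides are the sum of x^(q^i) over i <= t, split at the bottom and at the
    top. With x^(q^t) = x, the trace is fixed by Frobenius.\<close>
  have "x + ff_trace q t x ^ q = x ^ (q ^ t) + ff_trace q t x"
    unfolding frobenius_ff_trace unfolding ff_trace_def
    using sum.lessThan_Suc_shift[of "\<lambda>i. x ^ (q ^ i)" t] sum.lessThan_Suc[of "\<lambda>i. x ^ (q ^ i)" t]
    by (simp add: add.commute)
  then show ?thesis
    using assms power_qt_K power_q_F by auto
qed

section \<open>Conjugates of the generator and the different\<close>

definition conjugates :: "'a set" where
  "conjugates = (\<lambda>i. \<alpha> ^ (q ^ i)) ` {..<t}"

text \<open>\<open>different \<alpha>\<close> is \<open>f' \<alpha>\<close> for the minimal polynomial \<open>f\<close> of \<open>\<alpha>\<close> over \<open>F\<close>.\<close>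
definition different :: "'a \<Rightarrow> 'a" where
  "different x = (\<Prod>y\<in>conjugates - {x}. x - y)"

text \<open>With this weight, the powers 1, \<alpha>, ..., \<alpha>^(t-1) have a Gram matrix for the
  trace form with zeros where the exponents sum to less than t - 1 and ones where they sum to t -
  1.\<close>

abbreviation dual :: 'a where
  "dual \<equiv> inverse (different \<alpha>)"

lemma finite_conjugates: "finite conjugates"
  by (simp add: conjugates_def)

lemma card_conjugates: "card conjugates = t"
  using card_image[OF inj_conjugates] by (simp add: conjugates_def)

lemma conjugates_subset_K: "conjugates \<subseteq> K"
  using is_subfield_power[OF subfield_K \<alpha>] by (auto simp: conjugates_def)

lemma frobenius_inj: "inj (\<lambda>x::'a. x ^ q)"
proof (rule injI)
  fix x y :: 'a
  assume "x ^ q = y ^ q"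
  then have "(x - y) ^ q = 0"
    using frobenius_minus[of x y 1] by simp
  then show "x = y"
    by simp
qed

lemma bij_betw_frobenius_conjugates: "bij_betw (\<lambda>x. x ^ q) conjugates conjugates"
proof -
  have "x ^ q \<in> conjugates" if x: "x \<in> conjugates" for x
  proof -
    obtain i where i: "i < t" "x = \<alpha> ^ (q ^ i)"
      using x by (auto simp: conjugates_def)
    then have eq: "x ^ q = \<alpha> ^ (q ^ Suc i)"
      by (simp add: power_mult[symmetric] mult.commute)
    show ?thesis
    proof (cases "Suc i < t")
      case True
      then show ?thesis
        unfolding conjugates_def eq by blast
    next
      case False
      then have "Suc i = t"
        using i by simp
      then have "x ^ q = \<alpha> ^ (q ^ 0)"
        using eq power_qt_K[of \<alpha>] \<alpha> by simp
      then show ?thesis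
        unfolding conjugates_def using t_pos by blast
    qed
  qed
  then have "(\<lambda>x. x ^ q) ` conjugates \<subseteq> conjugates"
    by blast
  moreover have inj: "inj_on (\<lambda>x. x ^ q) conjugates"
    using frobenius_inj by (rule inj_on_subset) simp
  ultimately show ?thesis
    by (simp add: bij_betw_def endo_inj_surj finite_conjugates)
qed

lemma different_frobenius:
  assumes x: "x \<in> conjugates"
  shows "different (x ^ q) = different x ^ q"
proof -
  have "bij_betw (\<lambda>y. y ^ q) (conjugates - {x}) (conjugates - {x ^ q})"
    using bij_betw_DiffI[OF bij_betw_frobenius_conjugates, of "{x}" "{x ^ q}"] x
      bij_betw_frobenius_conjugates by (auto simp: bij_betw_def)
  then have "different (x ^ q) = (\<Prod>y\<in>conjugates - {x}. x ^ q - y ^ q)"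
    unfolding different_def by (rule prod.reindex_bij_betw[symmetric])
  also have "\<dots> = (\<Prod>y\<in>conjugates - {x}. (x - y) ^ q)"
    using frobenius_minus[of _ _ 1] by simp
  finally show ?thesis
    by (simp add: different_def prod_power_distrib)
qed

lemma \<alpha>_in_conjugates: "\<alpha> \<in> conjugates"
  unfolding conjugates_def using t_pos by (intro image_eqI[of _ _ 0]) auto

lemma power_qi_in_conjugates: "\<alpha> ^ (q ^ i) \<in> conjugates"
proof (induction i)
  case (Suc i)
  then show ?case
    using bij_betw_frobenius_conjugates
    by (auto simp: bij_betw_def power_mult[symmetric] mult.commute dest!: equalityD1)
qed (simp add: \<alpha>_in_conjugates)

text \<open>Frobenius permutes the conjugates, so it carries f' at one conjugate to f' at the next.
  The conjugates of \<open>dual\<close> are thus the weights in Euler's formula.\<close>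

lemma different_power_qi: "different (\<alpha> ^ (q ^ i)) = different \<alpha> ^ (q ^ i)"
proof (induction i)
  case (Suc i)
  have "different (\<alpha> ^ (q ^ Suc i)) = different ((\<alpha> ^ (q ^ i)) ^ q)"
    by (simp add: power_mult[symmetric] mult.commute)
  also have "\<dots> = (different \<alpha> ^ (q ^ i)) ^ q"
    by (simp only: different_frobenius[OF power_qi_in_conjugates] Suc.IH)
  finally show ?case
    by (simp add: power_mult[symmetric] mult.commute)
qed simp

lemma different_nonzero: "different \<alpha> \<noteq> 0"
  by (simp add: different_def finite_conjugates)

lemma different_in_K: "different \<alpha> \<in> K"
  unfolding different_def using conjugates_subset_K \<alpha>
  by (intro is_subfield_prod[OF subfield_K] is_subfieldD(3)[OF subfield_K]) auto

lemma dual_in_K: "dual \<in> K"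
  using different_in_K is_subfieldD(5)[OF subfield_K] by blast

text \<open>As P has coefficients in F, the trace is the sum of P(x) / f'(x) over the conjugates x
  of \<alpha>, to which Lagrange interpolation applies.\<close>

lemma ff_trace_dual_poly:
  assumes P: "\<And>i. coeff P i \<in> F" and deg: "degree P < t"
  shows "ff_trace q t (dual * poly P \<alpha>) = coeff P (t - 1)"
proof -
  have "ff_trace q t (dual * poly P \<alpha>)
      = (\<Sum>i<t. poly P (\<alpha> ^ (q ^ i)) / different (\<alpha> ^ (q ^ i)))"
    by (simp add: ff_trace_def power_mult_distrib frobenius_poly[OF P] different_power_qi power_inverse
        divide_inverse mult.commute)
  also have "\<dots> = (\<Sum>x\<in>conjugates. poly P x / different x)"
    unfolding conjugates_def by (simp add: sum.reindex[OF inj_conjugates] o_def)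
  also have "\<dots> = coeff P (t - 1)"
    using sum_poly_div_prod_differences[OF finite_conjugates, of P] deg
    by (simp add: different_def card_conjugates)
  finally show ?thesis .
qed

section \<open>Polynomial coordinates on K and the fibres of the trace\<close>

lemma polys_below_degree:
  assumes "P \<in> polys_below F n" "n > 0"
  shows "degree P < n"
  using assms by (intro degree_lessI) (auto simp: polys_below_def)

lemma poly_in_K:
  assumes "P \<in> polys_below F n"
  shows "poly P \<alpha> \<in> K"
  unfolding poly_altdef using assms F_subset_K \<alpha>
  by (intro is_subfield_sum[OF subfield_K] is_subfieldD(4)[OF subfield_K] is_subfield_power[OF subfield_K])
    (auto simp: polys_below_def)

text \<open>Two polynomials over F that agree at \<alpha> agree at all t conjugates, hence coincide
  if their degrees are below t; surjectivity follows by counting.\<close>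

lemma bij_betw_poly: "bij_betw (\<lambda>P. poly P \<alpha>) (polys_below F t) K"
proof -
  have card: "finite (polys_below F t)" "card (polys_below F t) = card K"
    using card_polys_below[of F t] is_subfieldD(1)[OF subfield_F] card_F card_K by auto
  have inj: "inj_on (\<lambda>P. poly P \<alpha>) (polys_below F t)"
  proof (rule inj_onI)
    fix P Q assume P: "P \<in> polys_below F t" and Q: "Q \<in> polys_below F t"
      and eq: "poly P \<alpha> = poly Q \<alpha>"
    show "P = Q"
    proof (rule poly_eqI_degree[of conjugates])
      fix x assume "x \<in> conjugates"
      then obtain i where "x = \<alpha> ^ (q ^ i)"
        by (auto simp: conjugates_def)
      then show "poly P x = poly Q x"
        using frobenius_poly[of P \<alpha> i] frobenius_poly[of Q \<alpha> i] P Q eq by (simp add: polys_below_def)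
    qed (use polys_below_degree[OF P t_pos] polys_below_degree[OF Q t_pos] card_conjugates in auto)
  qed
  moreover have "(\<lambda>P. poly P \<alpha>) ` polys_below F t = K"
    using card_image[OF inj] card poly_in_K by (intro card_subset_eq) auto
  ultimately show ?thesis
    by (simp add: bij_betw_def)
qed

lemma sum_by_trace:
  fixes f :: "'a \<Rightarrow> 'b::comm_monoid_add"
  shows "(\<Sum>b\<in>F. \<Sum>x\<in>{x \<in> K. ff_trace q t x = b}. f x) = (\<Sum>x\<in>K. f x)"
  by (rule sum.group) (auto intro: ff_trace_in_F)

lemma card_trace_eq:
  assumes b: "b \<in> F"
  shows "card {x \<in> K. ff_trace q t x = b} = q ^ (t - 1)"
proof -
  have shift: "card {x \<in> K. ff_trace q t x = c} = card {x \<in> K. ff_trace q t x = 0}" if c: "c \<in> F" for c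
  proof -
    \<comment> \<open>Euler's formula gives trace 1 to \<open>dual\<close> times \<alpha>^(t-1).
      Translation by c times this element identifies the fibres over c and 0.\<close>
    let ?P = "monom 1 (t - 1) :: 'a poly"
    define e where "e = c * (dual * poly ?P \<alpha>)"
    have "coeff ?P i \<in> F" for i
      using is_subfieldD(1,2)[OF subfield_F] by simp
    moreover have "degree ?P < t"
      using t_pos by (simp add: degree_monom_eq)
    ultimately have "ff_trace q t e = c"
      unfolding e_def using c by (simp add: ff_trace_scale ff_trace_dual_poly)
    moreover have "e \<in> K"
      unfolding e_def using c F_subset_K dual_in_K \<alpha> is_subfield_intros[OF subfield_K]
      by (auto simp: poly_monom)
    ultimately have "bij_betw (\<lambda>x. x - e) {x \<in> K. ff_trace q t x = c} {x \<in> K. ff_trace q t x = 0}"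
      using is_subfield_intros[OF subfield_K]
      by (intro bij_betwI[where g = "\<lambda>x. x + e"]) (auto simp: ff_trace_diff ff_trace_add)
    then show ?thesis
      by (rule bij_betw_same_card)
  qed
  have "q ^ t = (\<Sum>c\<in>F. card {x \<in> K. ff_trace q t x = c})"
    using sum_by_trace[of "\<lambda>_. 1::nat"] card_K by simp
  also have "\<dots> = q * card {x \<in> K. ff_trace q t x = b}"
    using shift b card_F by simp
  finally show ?thesis
    using q_ge_2 t_pos by (simp add: power_eq_if)
qed

end

section \<open>Counting values of the quadratic form\<close>

context field_tower
begin

abbreviation form :: "'a poly \<Rightarrow> 'a" where
  "form P \<equiv> ff_trace q t (dual * poly P \<alpha> ^ 2)"

definition form_count :: "nat \<Rightarrow> 'a \<Rightarrow> int" where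
  "form_count n b = int (card {P \<in> polys_below F n. form P = b})"

lemma finite_polys_below: "finite (polys_below F n)"
  using card_polys_below[of F n] is_subfieldD(1)[OF subfield_F] by simp

lemma card_polys_below_F: "card (polys_below F n) = q ^ n"
  using card_polys_below[of F n] is_subfieldD(1)[OF subfield_F] card_F by simp

lemma coeff_mult_in_F:
  assumes "\<And>i. coeff P i \<in> F" "\<And>i. coeff Q i \<in> F"
  shows "coeff (P * Q) i \<in> F"
  unfolding coeff_mult using assms
  by (intro is_subfield_sum[OF subfield_F] is_subfieldD(4)[OF subfield_F]) auto

text \<open>The two degrees are at most m - 1 and n - 1, so m + n <= t + 1 is exactly what keeps the
  product within the range of Euler's formula.\<close>

lemma ff_trace_dual_mult:
  assumes "P \<in> polys_below F m" "Q \<in> polys_below F n" "m > 0" "n > 0" "m + n \<le> Suc t"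
  shows "ff_trace q t (dual * (poly P \<alpha> * poly Q \<alpha>)) = coeff (P * Q) (t - 1)"
proof -
  have "degree (P * Q) \<le> degree P + degree Q"
    by (rule degree_mult_le)
  then have "degree (P * Q) < t"
    using polys_below_degree[OF assms(1,3)] polys_below_degree[OF assms(2,4)] assms(5) by linarith
  moreover have "coeff (P * Q) i \<in> F" for i
    using coeff_mult_in_F assms(1,2) by (simp add: polys_below_def)
  ultimately show ?thesis
    using ff_trace_dual_poly[of "P * Q"] by simp
qed

lemma coeff_mult_polys_below:
  assumes "P \<in> polys_below F (Suc m)" "Q \<in> polys_below F (Suc n)"
  shows "coeff (P * Q) (m + n) = coeff P m * coeff Q n"
proof -
  have "coeff P i * coeff Q (m + n - i) = 0" if "i \<in> {..m + n} - {m}" for i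
    using that assms by (cases "i < m") (auto simp: polys_below_def)
  then have "(\<Sum>i\<in>{..m + n} - {m}. coeff P i * coeff Q (m + n - i)) = 0"
    by (intro sum.neutral) blast
  then show ?thesis
    unfolding coeff_mult by (subst sum.remove[of _ m]) auto
qed

lemma polys_below_0: "polys_below F 0 = {0}"
  using is_subfieldD(1)[OF subfield_F] by (auto simp: polys_below_def intro: poly_eqI)

lemma polys_below_mono: "m \<le> n \<Longrightarrow> polys_below F m \<subseteq> polys_below F n"
  by (auto simp: polys_below_def)

text \<open>Here P^2 has degree at most 2n - 2 < t - 1, so the form vanishes identically. With n = t
  / 2 this is the starting point for even t.\<close>

lemma form_count_isotropic:
  assumes n: "2 * n \<le> t" and b: "b \<noteq> 0"
  shows "form_count n b - form_count n 0 = - int (q ^ n)"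
proof -
  have form: "form P = 0" if P: "P \<in> polys_below F n" for P
  proof (cases n)
    case 0
    then show ?thesis
      using P by (simp add: polys_below_0)
  next
    case (Suc k)
    then have "degree (P * P) < t - 1"
      using degree_mult_le[of P P] polys_below_degree[OF P] n by linarith
    then have "coeff (P * P) (t - 1) = 0"
      by (rule coeff_eq_0)
    then show ?thesis
      using ff_trace_dual_mult[OF P P] n Suc by (simp add: power2_eq_square)
  qed
  then have "{P \<in> polys_below F n. form P = 0} = polys_below F n" "{P \<in> polys_below F n. form P = b} = {}"
    using b by auto
  then show ?thesis
    by (simp only: form_count_def card_polys_below_F card.empty)
qed

text \<open>The starting point for odd t: P^2 has degree at most t - 1 = 2k, so the form is the
  square of the coefficient of X^k and the k lower coefficients are free.\<close>

lemma form_count_middle: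
  assumes t: "t = 2 * k + 1" and b: "b \<in> F"
  shows "form_count (Suc k) b = int (q ^ k) * (1 + quadratic_character F b)"
proof -
  have form: "form P = coeff P k ^ 2" if "P \<in> polys_below F (Suc k)" for P
    using ff_trace_dual_mult[OF that that] coeff_mult_polys_below[OF that that] t
    by (simp add: power2_eq_square mult_2)
  have card: "card {P \<in> polys_below F (Suc k). coeff P k = c} = q ^ k" if c: "c \<in> F" for c
  proof -
    have "bij_betw (\<lambda>P. P - monom c k) {P \<in> polys_below F (Suc k). coeff P k = c} (polys_below F k)"
    proof (rule bij_betwI[where g = "\<lambda>P. P + monom c k"])
      show "(\<lambda>P. P - monom c k) \<in> {P \<in> polys_below F (Suc k). coeff P k = c} \<rightarrow> polys_below F k"
      proof
        fix P assume P: "P \<in> {P \<in> polys_below F (Suc k). coeff P k = c}"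
        have "coeff (P - monom c k) i = 0" if "i \<ge> k" for i
          using P that by (cases "i = k") (auto simp: polys_below_def)
        then show "P - monom c k \<in> polys_below F k"
          using P c is_subfield_intros[OF subfield_F] by (auto simp: polys_below_def)
      qed
      show "(\<lambda>P. P + monom c k) \<in> polys_below F k \<rightarrow> {P \<in> polys_below F (Suc k). coeff P k = c}"
        using c is_subfield_intros[OF subfield_F] by (auto simp: polys_below_def)
    qed auto
    then show ?thesis
      using bij_betw_same_card card_polys_below_F by metis
  qed
  have "form_count (Suc k) b = int (card {P \<in> polys_below F (Suc k). coeff P k ^ 2 = b})"
    using form by (auto simp: form_count_def intro!: arg_cong[where f = card])
  also have "{P \<in> polys_below F (Suc k). coeff P k ^ 2 = b}
      = (\<Union>c\<in>{c \<in> F. c ^ 2 = b}. {P \<in> polys_below F (Suc k). coeff P k = c})"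
    by (auto simp: polys_below_def)
  also have "card \<dots> = (\<Sum>c\<in>{c \<in> F. c ^ 2 = b}. card {P \<in> polys_below F (Suc k). coeff P k = c})"
    by (rule card_UN_disjoint) (auto simp: finite_polys_below)
  also have "\<dots> = card {c \<in> F. c ^ 2 = b} * q ^ k"
    using card by simp
  finally show ?thesis
    using card_square_roots[OF subfield_F two b] by simp
qed

text \<open>A polynomial of degree \<open>n\<close> pairs nontrivially with the isotropic vector
  \<open>X ^ (t - 1 - n)\<close>, and adding multiples of the latter moves the value of the form freely.\<close>
lemma form_count_step:
  assumes n: "n < t" "t \<le> 2 * n" and b: "b \<in> F"
  shows "form_count (Suc n) b - form_count (Suc n) 0 = form_count n b - form_count n 0"
proof -
  \<comment> \<open>Chosen so that X^j times a polynomial of degree n has degree t - 1. The bound t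
    <= 2n gives j < n, so adding multiples of X^j preserves the coefficient of X^n, and 2j < t - 1
    makes X^j isotropic.\<close>
  define j where "j = t - 1 - n"
  have j: "j < n" "n + j = t - 1"
    using n by (auto simp: j_def)
  define A where "A = polys_below F (Suc n) - polys_below F n"
  have X: "monom c j \<in> polys_below F (Suc j)" if "c \<in> F" for c
    using that is_subfieldD(1)[OF subfield_F] by (auto simp: polys_below_def)
  have A: "P \<in> A \<longleftrightarrow> P \<in> polys_below F (Suc n) \<and> coeff P n \<noteq> 0" for P
  proof -
    have "(\<forall>i\<ge>n. coeff P i = 0) \<longleftrightarrow> coeff P n = 0" if "\<forall>i\<ge>Suc n. coeff P i = 0"
      using that by (metis le_antisym not_less_eq_eq order_refl)
    then show ?thesis
      by (auto simp: A_def polys_below_def)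
  qed
  have form_shift: "form (P + monom c j) = form P + 2 * c * coeff P n"
    if P: "P \<in> polys_below F (Suc n)" and c: "c \<in> F" for P c
  proof -
    have "ff_trace q t (dual * (poly P \<alpha> * poly (monom c j) \<alpha>)) = c * coeff P n"
      using ff_trace_dual_mult[OF P X[OF c]] coeff_mult_polys_below[OF P X[OF c]] j n by simp
    moreover have "ff_trace q t (dual * (poly (monom c j) \<alpha> * poly (monom c j) \<alpha>)) = 0"
      using ff_trace_dual_mult[OF X[OF c] X[OF c]] j n by (simp add: mult_monom)
    moreover have "dual * poly (P + monom c j) \<alpha> ^ 2
        = dual * poly P \<alpha> ^ 2 + (dual * (poly P \<alpha> * poly (monom c j) \<alpha>)
          + dual * (poly P \<alpha> * poly (monom c j) \<alpha>)) + dual * (poly (monom c j) \<alpha> * poly (monom c j) \<alpha>)"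
      by (simp add: power2_eq_square algebra_simps)
    ultimately show ?thesis
      by (simp only: ff_trace_add) (simp add: algebra_simps)
  qed
  \<comment> \<open>Adding c X^j changes the form by 2 c times the leading coefficient; the chosen c
    makes this b. The leading coefficient is unaffected, so the inverse map uses the same c.\<close>
  have "bij_betw (\<lambda>P. P - monom (b / (2 * coeff P n)) j) {P \<in> A. form P = b} {P \<in> A. form P = 0}"
  proof (rule bij_betwI[where g = "\<lambda>P. P + monom (b / (2 * coeff P n)) j"])
    have F: "b / (2 * coeff P n) \<in> F" if "P \<in> A" for P
      using that b is_subfield_intros[OF subfield_F] is_subfield_of_nat[OF subfield_F, of 2]
      by (auto simp: A polys_below_def)
    have in_A: "P + monom c j \<in> A" if "P \<in> A" "c \<in> F" for P c
      using that j is_subfieldD(1)[OF subfield_F]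
      by (auto simp: A polys_below_def intro!: is_subfield_add[OF subfield_F])
    have val: "form (P + monom (b / (2 * coeff P n)) j) = form P + b"
      "form (P + monom (- (b / (2 * coeff P n))) j) = form P - b" if "P \<in> A" for P
      using that form_shift[of P "b / (2 * coeff P n)"] form_shift[of P "- (b / (2 * coeff P n))"]
        F[OF that] is_subfield_uminus[OF subfield_F F[OF that]] two
      by (auto simp: A)
    have neg: "P - monom c j = P + monom (- c) j" for P :: "'a poly" and c
      by (simp add: minus_monom[symmetric])
    show "(\<lambda>P. P - monom (b / (2 * coeff P n)) j) \<in> {P \<in> A. form P = b} \<rightarrow> {P \<in> A. form P = 0}"
      unfolding neg using F in_A is_subfield_uminus[OF subfield_F] val by auto
    show "(\<lambda>P. P + monom (b / (2 * coeff P n)) j) \<in> {P \<in> A. form P = 0} \<rightarrow> {P \<in> A. form P = b}"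
      using F in_A val by auto
  qed (use j in auto)
  then have eq: "card {P \<in> A. form P = b} = card {P \<in> A. form P = 0}"
    by (rule bij_betw_same_card)
  have "form_count (Suc n) c = form_count n c + int (card {P \<in> A. form P = c})" for c
  proof -
    have "{P \<in> polys_below F (Suc n). form P = c} = {P \<in> polys_below F n. form P = c} \<union> {P \<in> A. form P = c}"
      using polys_below_mono[of n "Suc n"] by (auto simp: A_def)
    moreover have "card \<dots> = card {P \<in> polys_below F n. form P = c} + card {P \<in> A. form P = c}"
      by (rule card_Un_disjoint) (auto simp: A_def finite_polys_below)
    ultimately show ?thesis
      by (simp add: form_count_def)
  qed
  then show ?thesis
    using eq by simp
qed

lemma form_count_stable:
  assumes "t \<le> 2 * n" and b: "b \<in> F" and "n \<le> N" "N \<le> t"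
  shows "form_count N b - form_count N 0 = form_count n b - form_count n 0"
  using assms(3,4)
proof (induction N rule: dec_induct)
  case (step i)
  then show ?case
    using form_count_step[of i b] assms by simp
qed simp

definition char_sum :: "'a \<Rightarrow> int" where
  "char_sum b = (\<Sum>x\<in>{x \<in> K. ff_trace q t x = b}. quadratic_character K x)"

lemma odd_card_K: "odd (card K)"
  using odd_q card_K by simp

text \<open>Summing over x = y^2 with weight 1 + \<chi>(x) and then replacing
  \<open>dual * x\<close> by x pulls out the factor \<chi>(\<open>dual\<close>); the weight 1 counts
  a fibre of the trace.\<close>

lemma form_count_eq_char_sum:
  assumes b: "b \<in> F"
  shows "form_count t b = int (q ^ (t - 1)) + quadratic_character K dual * char_sum b"
proof -
  let ?f = "\<lambda>x. if ff_trace q t x = b then 1 else 0 :: int"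
  have dual0: "dual \<noteq> 0"
    using different_nonzero by simp
  have K: "dual * x \<in> K" "different \<alpha> * x \<in> K" if "x \<in> K" for x
    using that dual_in_K different_in_K is_subfieldD(4)[OF subfield_K] by blast+
  have \<chi>: "quadratic_character K x = quadratic_character K dual * quadratic_character K (dual * x)"
    if x: "x \<in> K" for x
  proof -
    have "quadratic_character K dual ^ 2 = 1"
      using quadratic_character_sign[OF dual0, of K] by auto
    then show ?thesis
      using quadratic_character_mult[OF subfield_K two odd_card_K dual_in_K x]
      by (simp add: power2_eq_square)
  qed
  have "bij_betw (\<lambda>P. poly P \<alpha>) {P \<in> polys_below F t. form P = b}
      {y \<in> K. ff_trace q t (dual * y ^ 2) = b}"
    using bij_betw_poly by (rule bij_betw_Collect) simp
  then have "card {P \<in> polys_below F t. form P = b} = card {y \<in> K. ff_trace q t (dual * y ^ 2) = b}"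
    by (rule bij_betw_same_card)
  then have "form_count t b = int (card {y \<in> K. ff_trace q t (dual * y ^ 2) = b})"
    by (simp only: form_count_def)
  also have "\<dots> = (\<Sum>y\<in>K. ?f (dual * y ^ 2))"
    by (simp add: sum.If_cases Int_def)
  also have "\<dots> = (\<Sum>x\<in>K. (1 + quadratic_character K x) * ?f (dual * x))"
    by (rule sum_comp_square[OF subfield_K two])
  also have "\<dots> = (\<Sum>x\<in>K. (1 + quadratic_character K dual * quadratic_character K (dual * x)) * ?f (dual * x))"
    by (rule sum.cong) (auto simp: \<chi>[symmetric])
  also have "\<dots> = (\<Sum>x\<in>K. (1 + quadratic_character K dual * quadratic_character K x) * ?f x)"
    by (rule sum.reindex_bij_witness[of _ "\<lambda>x. different \<alpha> * x" "\<lambda>x. dual * x"])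
      (use K different_nonzero in auto)
  also have "\<dots> = (\<Sum>x\<in>K. if ff_trace q t x = b then 1 + quadratic_character K dual * quadratic_character K x else 0)"
    by (rule sum.cong) auto
  also have "\<dots> = (\<Sum>x\<in>{x \<in> K. ff_trace q t x = b}. 1 + quadratic_character K dual * quadratic_character K x)"
    by (simp add: sum.If_cases Int_def)
  also have "\<dots> = int (card {x \<in> K. ff_trace q t x = b}) + quadratic_character K dual * char_sum b"
    by (simp add: sum.distrib char_sum_def sum_distrib_left)
  finally show ?thesis
    using card_trace_eq[OF b] by simp
qed

lemma sum_char_sum: "(\<Sum>b\<in>F. char_sum b) = 0"
  unfolding char_sum_def sum_by_trace by (rule sum_quadratic_character[OF subfield_K two])

end

section \<open>Evaluation of the character sum\<close>

lemma geometric_sum_nat: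
  fixes q :: nat
  assumes "q > 0"
  shows "(q - 1) * (\<Sum>i<n. q ^ i) = q ^ n - 1"
proof (induction n)
  case (Suc n)
  have "(q - 1) * (\<Sum>i<Suc n. q ^ i) = q ^ n - 1 + (q - 1) * q ^ n"
    using Suc.IH by (simp add: distrib_left)
  also have "\<dots> = q ^ Suc n - 1"
    using assms by (simp add: diff_mult_distrib)
  finally show ?case .
qed simp

text \<open>The exponent of Euler's criterion over the larger field is that of the norm times that
  of the criterion over the smaller one.\<close>

lemma half_power_minus_1:
  fixes q :: nat
  assumes "odd q"
  shows "(q ^ n - 1) div 2 = (\<Sum>i<n. q ^ i) * ((q - 1) div 2)"
proof -
  have "q > 0"
    using assms by (rule odd_pos)
  have "q - 1 = 2 * ((q - 1) div 2)"
    using assms by simp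
  then have "q ^ n - 1 = 2 * ((q - 1) div 2) * (\<Sum>i<n. q ^ i)"
    using geometric_sum_nat[OF \<open>q > 0\<close>, of n] by simp
  then show ?thesis
    by (simp add: mult.assoc mult.commute)
qed

context field_tower
begin

text \<open>The norm of the different is, up to sign, the square of the Vandermonde product of the
  conjugates, and Frobenius multiplies that product by the sign of a \<open>t\<close>-cycle.\<close>
lemma quadratic_character_dual:
  "quadratic_character K dual
    = quadratic_character F ((- 1) ^ (t * (t - 1) div 2)) * (- 1) ^ (t - 1)"
proof (rule of_int_sign_eqD[OF two])
  define a where "a i = \<alpha> ^ (q ^ i)" for i
  define V where "V = (\<Prod>j<t. \<Prod>i<j. a j - a i)"
  define u where "u = (q - 1) div 2"
  have u: "q - 1 = 2 * u"
    using odd_q by (simp add: u_def)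
  have inj: "inj_on a {..<t}"
    using inj_conjugates by (simp add: a_def[abs_def])
  have C: "conjugates = a ` {..<t}"
    by (simp add: conjugates_def a_def)
  have "different (a j) = (\<Prod>i\<in>{..<t} - {j}. a j - a i)" if "j < t" for j
  proof -
    have "conjugates - {a j} = a ` ({..<t} - {j})"
      using inj_on_image_set_diff[OF inj, of "{..<t}" "{j}"] that by (simp add: C)
    moreover have "inj_on a ({..<t} - {j})"
      using inj by (rule inj_on_subset) auto
    ultimately show ?thesis
      by (simp add: different_def prod.reindex)
  qed
  then have "(\<Prod>j<t. different (a j)) = (\<Prod>j<t. \<Prod>i\<in>{..<t} - {j}. a j - a i)"
    by simp
  also have "\<dots> = (- 1) ^ (t * (t - 1) div 2) * V ^ 2"
    unfolding V_def by (rule prod_differences_eq_square)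
  \<comment> \<open>The left side is the norm of f'(\<alpha>) from K to F, the product of its
    conjugates.\<close>
  finally have N: "different \<alpha> ^ (\<Sum>i<t. q ^ i) = (- 1) ^ (t * (t - 1) div 2) * V ^ 2"
    by (simp add: a_def different_power_qi power_sum)
  have "a t = a 0"
    using power_qt_K \<alpha> by (simp add: a_def)
  moreover have "a j ^ q = a (Suc j)" for j
    by (simp add: a_def power_mult[symmetric] mult.commute)
  then have "V ^ q = (\<Prod>j<t. \<Prod>i<j. a (Suc j) - a (Suc i))"
    using frobenius_minus[of _ _ 1] by (simp add: V_def prod_power_distrib)
  ultimately have "V ^ q = (- 1) ^ (t - 1) * V"
    using prod_differences_cyclic_shift[OF t_pos, of a] by (simp add: V_def)
  moreover have "V ^ q = V ^ (q - 1) * V"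
    using q_ge_2 by (simp add: power_eq_if)
  moreover have "a j - a i \<noteq> 0" if "i < j" "j < t" for i j
    using inj_onD[OF inj, of j i] that by auto
  then have "V \<noteq> 0"
    by (auto simp: V_def)
  \<comment> \<open>For even t this is -1: \<open>V\<close> is then not in F, and
    \<open>V ^ 2\<close> is a nonsquare of F.\<close>
  ultimately have V: "V ^ (2 * u) = (- 1) ^ (t - 1)"
    using u by simp
  have "of_int (quadratic_character K dual) = of_int (quadratic_character K (different \<alpha>))"
    using quadratic_character_inverse[OF subfield_K different_in_K different_nonzero] by simp
  also have "\<dots> = different \<alpha> ^ ((q ^ t - 1) div 2)"
    using quadratic_character_eq_power[OF subfield_K two odd_card_K different_in_K] card_K by simp
  also have "\<dots> = (different \<alpha> ^ (\<Sum>i<t. q ^ i)) ^ u"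
    by (simp only: half_power_minus_1[OF odd_q] u_def power_mult)
  also have "\<dots> = ((- 1 :: 'a) ^ (t * (t - 1) div 2)) ^ u * V ^ (2 * u)"
    by (simp only: N power_mult_distrib power_mult)
  also have "((- 1 :: 'a) ^ (t * (t - 1) div 2)) ^ u = of_int (quadratic_character F ((- 1) ^ (t * (t - 1) div 2)))"
    using quadratic_character_eq_power[OF subfield_F two, of "(- 1) ^ (t * (t - 1) div 2)"] odd_q card_F
      is_subfield_power[OF subfield_F is_subfield_uminus[OF subfield_F is_subfieldD(2)[OF subfield_F]]]
    by (simp add: u_def)
  finally show "of_int (quadratic_character K dual)
      = (of_int (quadratic_character F ((- 1) ^ (t * (t - 1) div 2)) * (- 1) ^ (t - 1)) :: 'a)"
    unfolding V by simp
  show "quadratic_character F ((- 1) ^ (t * (t - 1) div 2)) * (- 1) ^ (t - 1) \<in> {1, - 1}"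
    using quadratic_character_sign[of "(- 1) ^ (t * (t - 1) div 2)" F]
    by (cases "even (t - 1)") auto
qed (use quadratic_character_sign[of dual K] different_nonzero in auto)

lemma sum_char_sum_remove: "char_sum 0 + (\<Sum>b\<in>F - {0}. char_sum b) = 0"
  using sum_char_sum is_subfieldD(1)[OF subfield_F] by (simp add: sum.remove[of F 0])

lemma char_sum_diff:
  assumes "b \<in> F"
  shows "char_sum b = char_sum 0 + quadratic_character K dual * (form_count t b - form_count t 0)"
proof -
  have "quadratic_character K dual * quadratic_character K dual = 1"
    using quadratic_character_sign[of dual K] different_nonzero by auto
  moreover have "quadratic_character K dual * (form_count t b - form_count t 0)
      = (quadratic_character K dual * quadratic_character K dual) * (char_sum b - char_sum 0)"
    using form_count_eq_char_sum[OF assms] form_count_eq_char_sum[OF is_subfieldD(1)[OF subfield_F]]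
    by (simp add: algebra_simps)
  ultimately show ?thesis
    by simp
qed

text \<open>All E(b) with b nonzero exceed E(0) by s q^(t/2), where s = \<rho>((-1)^(t/2)). As all
  values sum to zero, q E(0) = -(q - 1) s q^(t/2).\<close>

lemma char_sum_even:
  assumes t: "even t" and b: "b \<in> F"
  shows "char_sum b = (if b = 0 then - (int q - 1) else 1) * int q ^ ((t - 2) div 2)
    * quadratic_character F ((- 1) ^ (t div 2))"
proof -
  have "t = 2 * Suc (t div 2 - 1)"
    using t t_pos by presburger
  then obtain k where k: "t = 2 * Suc k" ..
  define s where "s = quadratic_character F ((- 1) ^ Suc k)"
  have "t * (t - 1) div 2 = Suc k * (2 * k + 1)"
    by (simp add: k)
  \<comment> \<open>The cofactor 2k + 1 is odd. The sign (-1)^(t-1) = -1 then turns s into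
    -s.\<close>
  then have "(- 1 :: 'a) ^ (t * (t - 1) div 2) = (- 1) ^ Suc k"
    by (simp only: power_mult) (cases "even k"; simp)
  then have dual: "quadratic_character K dual = - s"
    using quadratic_character_dual by (simp add: k s_def)
  have diff: "char_sum b = char_sum 0 + s * int q ^ Suc k" if "b \<in> F - {0}" for b
  proof -
    have "Suc k \<le> t" "t \<le> 2 * Suc k" "2 * Suc k \<le> t"
      using k by auto
    then have "form_count t b - form_count t 0 = - (int q ^ Suc k)"
      using form_count_stable[of "Suc k" b t] form_count_isotropic[of "Suc k" b] that by simp
    then show ?thesis
      using char_sum_diff[of b] dual that by simp
  qed
  have "(\<Sum>b\<in>F - {0}. char_sum b) = (int q - 1) * (char_sum 0 + s * int q ^ Suc k)"
    using diff is_subfieldD(1)[OF subfield_F] card_F q_ge_2 by (simp add: of_nat_diff)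
  then have "int q * char_sum 0 = int q * (- (int q - 1) * s * int q ^ k)"
    using sum_char_sum_remove by (simp add: algebra_simps)
  then have zero: "char_sum 0 = - (int q - 1) * s * int q ^ k"
    using q_ge_2 by (simp only: mult_cancel_left) auto
  have "(t - 2) div 2 = k" "t div 2 = Suc k"
    by (simp_all add: k)
  then show ?thesis
    using zero diff[of b] b by (auto simp: s_def algebra_simps)
qed

text \<open>E(b) - E(0) is a multiple of \<rho>(b), which sums to zero over F, so E(0) = 0.\<close>

lemma char_sum_odd:
  assumes t: "odd t" and b: "b \<in> F"
  shows "char_sum b = int q ^ ((t - 1) div 2) * quadratic_character F ((- 1) ^ ((t - 1) div 2) * b)"
proof -
  obtain k where k: "t = 2 * k + 1"
    using t by (rule oddE)
  define s where "s = quadratic_character F ((- 1) ^ k)"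
  have "t * (t - 1) div 2 = k * (2 * k + 1)"
    by (simp add: k)
  then have "(- 1 :: 'a) ^ (t * (t - 1) div 2) = (- 1) ^ k"
    by (simp only: power_mult) (cases "even k"; simp)
  then have dual: "quadratic_character K dual = s"
    using quadratic_character_dual by (simp add: k s_def)
  have diff: "char_sum b = char_sum 0 + s * int q ^ k * quadratic_character F b" if "b \<in> F" for b
  proof -
    have "Suc k \<le> t" "t \<le> 2 * Suc k"
      using k by auto
    then have "form_count t b - form_count t 0 = int q ^ k * quadratic_character F b"
      using form_count_stable[of "Suc k" b t] form_count_middle[OF k, of b]
        form_count_middle[OF k, of 0] that is_subfieldD(1)[OF subfield_F]
      by (simp add: algebra_simps)
    then show ?thesis
      using char_sum_diff[OF that] dual by simp
  qed
  have "(\<Sum>b\<in>F. char_sum b) = (\<Sum>b\<in>F. char_sum 0 + s * int q ^ k * quadratic_character F b)"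
    using diff by (intro sum.cong) auto
  also have "\<dots> = int q * char_sum 0"
    using sum_quadratic_character[OF subfield_F two] card_F
    by (simp add: sum.distrib sum_distrib_left[symmetric])
  finally have "char_sum 0 = 0"
    using sum_char_sum q_ge_2 by simp
  moreover have "quadratic_character F ((- 1) ^ k * b) = s * quadratic_character F b"
    unfolding s_def
    using quadratic_character_mult[OF subfield_F two _ _ b, of "(- 1) ^ k"] odd_q card_F
      is_subfield_power[OF subfield_F is_subfield_uminus[OF subfield_F is_subfieldD(2)[OF subfield_F]]]
    by simp
  ultimately show ?thesis
    using diff[OF b] by (simp add: k)
qed

end

section \<open>The norm condition\<close>

lemma is_subfield_UNIV: "is_subfield UNIV"
  by (simp add: is_subfield_def)

section \<open>The characteristic and the powers of a primitive element\<close>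

lemma CHAR_eq_of_card:
  assumes "prime p" "CARD('a::finite_field) = p ^ n"
  shows "CHAR('a) = p"
proof -
  \<comment> \<open>Translation by 1 permutes the field, so its cardinality is zero in it.\<close>
  have "(\<Sum>x\<in>(UNIV :: 'a set). x + 1) = (\<Sum>x\<in>UNIV. x)"
    by (rule sum.reindex_bij_witness[of _ "\<lambda>x. x - 1" "\<lambda>x. x + 1"]) auto
  then have "of_nat (CARD('a)) = (0 :: 'a)"
    by (simp add: sum.distrib)
  then have "CHAR('a) dvd p ^ n"
    using assms(2) by (simp only: of_nat_eq_0_iff_char_dvd)
  then have "CHAR('a) dvd p"
    using CHAR_prime prime_dvd_power by blast
  then show ?thesis
    using assms(1) CHAR_prime by (simp add: primes_dvd_imp_eq)
qed

lemma primitive_element_nonzero: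
  assumes "primitive_element \<gamma>"
  shows "\<gamma> \<noteq> 0"
proof -
  have "\<gamma> powi 1 \<in> cyclic_group \<gamma>"
    unfolding cyclic_group_def by (rule rangeI)
  then show ?thesis
    using assms by (simp add: primitive_element_def)
qed

lemma power_int_eq_power_mod:
  fixes \<gamma> :: "'a::field"
  assumes "\<gamma> \<noteq> 0" "\<gamma> ^ n = 1" "n > 0"
  shows "\<gamma> powi k = \<gamma> ^ nat (k mod int n)"
proof -
  have "\<gamma> powi k = \<gamma> powi (int n * (k div int n) + k mod int n)"
    by simp
  also have "\<dots> = (\<gamma> powi int n) powi (k div int n) * \<gamma> powi (k mod int n)"
    using assms(1) by (subst power_int_add) (simp_all only: power_int_mult simp_thms)
  also have "\<gamma> powi int n = 1"
    using assms(2) by simp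
  also have "\<gamma> powi (k mod int n) = \<gamma> ^ nat (k mod int n)"
    using assms(3) by (simp add: power_int_def)
  finally show ?thesis
    by simp
qed

lemma primitive_element_powers:
  fixes \<gamma> :: "'a::finite_field"
  assumes "primitive_element \<gamma>" "\<gamma> ^ n = 1" "n > 0"
  shows "UNIV - {0} = (\<lambda>k. \<gamma> ^ k) ` {..<n}"
proof
  show "UNIV - {0} \<subseteq> (\<lambda>k. \<gamma> ^ k) ` {..<n}"
  proof
    fix x :: 'a assume "x \<in> UNIV - {0}"
    then obtain k :: int where "x = \<gamma> powi k"
      using assms(1) by (auto simp: primitive_element_def cyclic_group_def)
    then have "x = \<gamma> ^ nat (k mod int n)"
      using power_int_eq_power_mod primitive_element_nonzero assms by metis
    moreover have "nat (k mod int n) < n"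
      using assms(3) by (simp add: nat_less_iff)
    ultimately show "x \<in> (\<lambda>k. \<gamma> ^ k) ` {..<n}"
      by blast
  qed
  show "(\<lambda>k. \<gamma> ^ k) ` {..<n} \<subseteq> UNIV - {0}"
    using primitive_element_nonzero[OF assms(1)] by auto
qed

lemma primitive_element_power_eq_1_iff:
  fixes \<gamma> :: "'a::finite_field"
  assumes "primitive_element \<gamma>"
  shows "\<gamma> ^ n = 1 \<longleftrightarrow> (CARD('a) - 1) dvd n"
proof -
  let ?N = "CARD('a) - 1"
  have N: "\<gamma> ^ ?N = 1" "?N > 0"
    using subfield_power_card_minus_1[OF is_subfield_UNIV, of \<gamma>] primitive_element_nonzero[OF assms]
      subfield_card_ge_2[OF is_subfield_UNIV, where 'a = 'a] by auto
  have small: "n = 0" if "\<gamma> ^ n = 1" "n < ?N" for n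
  proof (rule ccontr)
    assume "n \<noteq> 0"
    then have "card (UNIV - {0::'a}) \<le> n"
      using primitive_element_powers[OF assms that(1)] card_image_le[of "{..<n}" "\<lambda>k. \<gamma> ^ k"] by simp
    then show False
      using that(2) by (simp add: card_Diff_singleton)
  qed
  have "\<gamma> ^ (?N * (n div ?N) + n mod ?N) = \<gamma> ^ (n mod ?N)"
    by (simp only: power_add power_mult N(1) power_one mult_1)
  then have "\<gamma> ^ n = \<gamma> ^ (n mod ?N)"
    by (simp only: mult_div_mod_eq)
  moreover have "\<gamma> ^ (n mod ?N) = 1 \<longleftrightarrow> n mod ?N = 0"
    using small[of "n mod ?N"] mod_less_divisor[OF N(2), of n] power_0[of \<gamma>] by auto
  ultimately show ?thesis
    by (simp only: dvd_eq_mod_eq_0)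
qed

lemma primitive_element_powerE:
  fixes \<gamma> :: "'a::finite_field"
  assumes "primitive_element \<gamma>" "x \<noteq> 0"
  obtains j where "x = \<gamma> ^ j"
proof -
  have "\<gamma> ^ (CARD('a) - 1) = 1" "CARD('a) - 1 > 0"
    using primitive_element_power_eq_1_iff[OF assms(1)]
      subfield_card_ge_2[OF is_subfield_UNIV, where 'a = 'a] by auto
  from primitive_element_powers[OF assms(1) this] assms(2)
  have "x \<in> (\<lambda>k. \<gamma> ^ k) ` {..<CARD('a) - 1}"
    by blast
  then show thesis
    using that by blast
qed

lemma ff_norm_eq_power: "ff_norm q m x = x ^ (\<Sum>i<m. q ^ i)"
  by (simp add: ff_norm_def power_sum)

lemma odd_sum_power:
  fixes q :: nat
  assumes "odd q"
  shows "odd (\<Sum>i<n. q ^ i) \<longleftrightarrow> odd n"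
  using assms by (induction n) auto

text \<open>For x = \<gamma>^j the norm is g^j. Raising to the power \<open>u\<close> sends g to -1,
  so both sides just compare the parities of j and h. For x = 0 both sides fail.\<close>

lemma ff_norm_in_coset_iff:
  fixes \<gamma> :: "'a::finite_field"
  assumes \<gamma>: "primitive_element \<gamma>" and card: "CARD('a) = q ^ m" and odd: "odd q"
    and two: "(2::'a) \<noteq> 0" and g: "g = ff_norm q m \<gamma>" and h: "h \<in> {0, 1}" and m: "m > 0"
  shows "ff_norm q m x \<in> (\<lambda>y. g ^ h * y) ` cyclic_group (g ^ 2)
    \<longleftrightarrow> quadratic_character UNIV x = (- 1) ^ h"
proof (cases "x = 0")
  case True
  have "q > 0"
    using odd by (rule odd_pos)
  then have "ff_norm q m x = 0"
    using True m by (auto simp: ff_norm_def)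
  moreover have "g \<noteq> 0"
    using primitive_element_nonzero[OF \<gamma>] by (simp add: g ff_norm_eq_power)
  ultimately show ?thesis
    using True by (auto simp: cyclic_group_def)
next
  case False
  define e where "e = (\<Sum>i<m. q ^ i)"
  define u where "u = (q - 1) div 2"
  have "CARD('a) \<ge> 2"
    using subfield_card_ge_2[OF is_subfield_UNIV, where 'a = 'a] by simp
  then have "q \<noteq> 1"
    using card by auto
  then have q: "q - 1 = 2 * u" "u > 0"
    using odd unfolding u_def by presburger+
  have eu: "(q ^ m - 1) div 2 = e * u" "odd (CARD('a))"
    using half_power_minus_1[OF odd, of m] odd card by (simp_all add: e_def u_def)
  have \<chi>: "of_int (quadratic_character UNIV y) = (y ^ e) ^ u" for y :: 'a
    using quadratic_character_eq_power[OF is_subfield_UNIV two eu(2), of y] eu(1) card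
    by (simp add: power_mult)
  have total: "CARD('a) - 1 = 2 * (e * u)"
    using geometric_sum_nat[OF odd_pos[OF odd], of m] q(1) card by (simp add: e_def mult_ac)
  have "e > 0"
    unfolding e_def using m odd_pos[OF odd] by (intro sum_pos) auto
  then have "\<not> 2 * (e * u) dvd e * u"
    using q(2) by (auto dest: dvd_imp_le)
  \<comment> \<open>\<gamma> has order 2 e u and g = \<gamma>^e, so \<open>g ^ u\<close> is a square
    root of 1 other than 1.\<close>
  then have "g ^ u \<noteq> 1"
    using primitive_element_power_eq_1_iff[OF \<gamma>, of "e * u"] total
    by (simp add: g ff_norm_eq_power e_def power_mult)
  moreover have "(g ^ u) ^ 2 = 1"
    using primitive_element_power_eq_1_iff[OF \<gamma>, of "e * (u * 2)"] total
    by (simp add: g ff_norm_eq_power e_def[symmetric] power_mult[symmetric] mult_ac)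
  ultimately have gu: "g ^ u = - 1"
    by (simp add: power2_eq_1_iff)
  obtain j where j: "x = \<gamma> ^ j"
    using primitive_element_powerE[OF \<gamma> False] .
  have norm: "ff_norm q m x = g ^ j"
    by (simp add: j g ff_norm_eq_power power_mult[symmetric] mult.commute)
  have "quadratic_character UNIV x = (- 1) ^ j"
  proof (rule of_int_sign_eqD[OF two])
    show "of_int (quadratic_character UNIV x) = (of_int ((- 1) ^ j) :: 'a)"
      using norm gu by (simp add: \<chi> ff_norm_eq_power e_def[symmetric])
        (metis power_mult mult.commute)
    show "(- 1) ^ j \<in> {1, - 1 :: int}"
      by (cases "even j") auto
  qed (rule quadratic_character_sign[OF False])
  also have "\<dots> = (- 1) ^ h \<longleftrightarrow> (even j \<longleftrightarrow> even h)"
    by (cases "even j"; cases "even h") auto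
  finally have rhs: "quadratic_character UNIV x = (- 1) ^ h \<longleftrightarrow> (even j \<longleftrightarrow> even h)" .
  have g0: "g \<noteq> 0"
    using primitive_element_nonzero[OF \<gamma>] by (simp add: g ff_norm_eq_power)
  show ?thesis
    unfolding norm rhs
  proof
    assume "g ^ j \<in> (\<lambda>y. g ^ h * y) ` cyclic_group (g ^ 2)"
    then obtain l :: int where "g ^ j = g ^ h * (g ^ 2) powi l"
      by (auto simp: cyclic_group_def)
    then have "(g ^ j) ^ u = (g ^ h) ^ u * ((g ^ 2) powi l) ^ u"
      by (simp add: power_mult_distrib)
    moreover have "((g ^ 2) powi l) ^ u = ((g ^ u) ^ 2) powi l"
      by (simp only: power_int_power power_int_power' power_mult[symmetric] mult_ac of_nat_mult)
    moreover have "(g ^ n) ^ u = (- 1) ^ n" for n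
      using gu by (metis power_mult mult.commute)
    ultimately have "(- 1 :: 'a) ^ j = (- 1) ^ h"
      using gu by simp
    moreover have "(1::'a) \<noteq> - 1"
      using two by (metis add.right_inverse one_add_one)
    ultimately show "even j \<longleftrightarrow> even h"
      by (cases "even j"; cases "even h") auto
  next
    assume parity: "even j \<longleftrightarrow> even h"
    \<comment> \<open>The subtraction does not truncate: h = 1 makes j odd, hence positive.\<close>
    then have "j = h + 2 * ((j - h) div 2)"
      using h by (elim insertE emptyE) presburger+
    then have "g ^ j = g ^ h * (g ^ 2) powi int ((j - h) div 2)"
      by (simp only: power_int_of_nat power_mult[symmetric] power_add[symmetric])
    then show "g ^ j \<in> (\<lambda>y. g ^ h * y) ` cyclic_group (g ^ 2)"
      unfolding cyclic_group_def by blast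
  qed
qed

text \<open>By Euler's criterion the exponent is the sum of \<open>card K ^ i\<close> over i < s, a
  sum of s odd numbers, and only its parity affects a sign.\<close>

lemma quadratic_character_UNIV_eq:
  fixes K :: "'a::finite_field set"
  assumes K: "is_subfield K" and two: "(2::'a) \<noteq> 0" and odd: "odd (card K)"
    and card: "CARD('a) = card K ^ s" and x: "x \<in> K" "x \<noteq> 0"
  shows "quadratic_character UNIV x = quadratic_character K x ^ s"
proof (rule of_int_sign_eqD[OF two])
  have sign: "quadratic_character K x \<in> {1, - 1}"
    by (rule quadratic_character_sign[OF x(2)])
  have "of_int (quadratic_character UNIV x) = x ^ ((card K ^ s - 1) div 2)"
    using quadratic_character_eq_power[OF is_subfield_UNIV two, of x] odd card by simp
  also have "\<dots> = (x ^ ((card K - 1) div 2)) ^ (\<Sum>i<s. card K ^ i)"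
    by (simp only: half_power_minus_1[OF odd] power_mult[symmetric] mult.commute)
  also have "x ^ ((card K - 1) div 2) = of_int (quadratic_character K x)"
    using quadratic_character_eq_power[OF K two odd x(1)] by simp
  also have "of_int (quadratic_character K x) ^ (\<Sum>i<s. card K ^ i)
      = (of_int (quadratic_character K x ^ s) :: 'a)"
    using sign odd_sum_power[OF odd, of s] by (cases "even s") auto
  finally show "of_int (quadratic_character UNIV x) = (of_int (quadratic_character K x ^ s) :: 'a)" .
  show "quadratic_character K x ^ s \<in> {1, - 1}"
    using sign by (cases "even s") auto
qed (rule quadratic_character_sign[OF x(2)])

text \<open>The conjugates x^(q^i) repeat with period t, so the s * t terms form s equal
  blocks.\<close>

lemma ff_trace_mult:
  assumes "x ^ (q ^ t) = x"
  shows "ff_trace q (s * t) x = of_nat s * ff_trace q t x"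
proof -
  have fix_power: "x ^ (q ^ (i + j * t)) = x ^ (q ^ i)" for i j
  proof (induction j)
    case (Suc j)
    have "x ^ (q ^ (i + Suc j * t)) = (x ^ (q ^ t)) ^ (q ^ (i + j * t))"
      by (simp only: power_mult[symmetric] power_add[symmetric]) (simp add: add_ac)
    then show ?case
      using Suc.IH assms by simp
  qed simp
  have "ff_trace q (s * t) x = (\<Sum>j<s. \<Sum>i\<in>{j * t..<j * t + t}. x ^ (q ^ i))"
    by (simp add: ff_trace_def sum.nat_group)
  also have "\<dots> = (\<Sum>j<s. \<Sum>i<t. x ^ (q ^ (i + j * t)))"
  proof (rule sum.cong)
    fix j
    show "(\<Sum>i\<in>{j * t..<j * t + t}. x ^ (q ^ i)) = (\<Sum>i<t. x ^ (q ^ (i + j * t)))"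
      using sum.shift_bounds_nat_ivl[of "\<lambda>i. x ^ (q ^ i)" 0 "j * t" t]
      by (simp add: add.commute atLeast0LessThan)
  qed simp
  also have "\<dots> = of_nat s * ff_trace q t x"
    by (simp add: fix_power ff_trace_def)
  finally show ?thesis .
qed

text \<open>The witness is \<gamma>^f with f = (q^(ts) - 1) / (q^t - 1), of order q^t - 1. Equal
  conjugates would make this order divide a positive q^j - q^i smaller than itself.\<close>

lemma subfield_generator:
  fixes \<gamma> :: "'a::finite_field" and K :: "'a set"
  assumes \<gamma>: "primitive_element \<gamma>" and K: "is_subfield K" "card K = q ^ t"
    and card: "CARD('a) = (q ^ t) ^ s" and "s > 0" "q \<ge> 2"
  obtains \<alpha> where "\<alpha> \<in> K" "inj_on (\<lambda>i. \<alpha> ^ (q ^ i)) {..<t}"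
proof
  define f where "f = (\<Sum>i<s. (q ^ t) ^ i)"
  have q_pos: "q > 0"
    using assms(6) by simp
  have total: "CARD('a) - 1 = f * (q ^ t - 1)"
    using geometric_sum_nat[of "q ^ t" s] card q_pos by (simp add: f_def mult.commute)
  have "f > 0"
    unfolding f_def using assms(5) q_pos by (intro sum_pos) auto
  have one_iff: "(\<gamma> ^ f) ^ n = 1 \<longleftrightarrow> q ^ t - 1 dvd n" for n
    using primitive_element_power_eq_1_iff[OF \<gamma>, of "f * n"] total \<open>f > 0\<close> by (simp add: power_mult)
  have "q ^ t = Suc (q ^ t - 1)"
    using q_pos by simp
  then have "(\<gamma> ^ f) ^ (q ^ t) = \<gamma> ^ f * (\<gamma> ^ f) ^ (q ^ t - 1)"
    by (metis power_Suc)
  also have "(\<gamma> ^ f) ^ (q ^ t - 1) = 1"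
    by (simp only: one_iff dvd_refl)
  finally show "\<gamma> ^ f \<in> K"
    using subfield_eq_fixed_points[OF K(1)] K(2) by auto
  have less: "(\<gamma> ^ f) ^ (q ^ i) \<noteq> (\<gamma> ^ f) ^ (q ^ j)" if "i < j" "j < t" for i j
  proof
    assume eq: "(\<gamma> ^ f) ^ (q ^ i) = (\<gamma> ^ f) ^ (q ^ j)"
    have ij: "q ^ i < q ^ j" "q ^ j < q ^ t" "1 \<le> q ^ i"
      using that assms(6) by auto
    have "(\<gamma> ^ f) ^ (q ^ i) * (\<gamma> ^ f) ^ (q ^ j - q ^ i) = (\<gamma> ^ f) ^ (q ^ i + (q ^ j - q ^ i))"
      by (simp only: power_add)
    also have "\<dots> = (\<gamma> ^ f) ^ (q ^ i)"
      using ij eq by simp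
    finally have "(\<gamma> ^ f) ^ (q ^ j - q ^ i) = 1"
      using primitive_element_nonzero[OF \<gamma>] by simp
    then have "q ^ t - 1 dvd q ^ j - q ^ i"
      by (simp only: one_iff)
    then have "q ^ t - 1 \<le> q ^ j - q ^ i"
      using ij by (intro dvd_imp_le) auto
    then show False
      using ij by linarith
  qed
  show "inj_on (\<lambda>i. (\<gamma> ^ f) ^ (q ^ i)) {..<t}"
    by (rule linorder_inj_onI) (use less in auto)
qed

section \<open>From character sums to the counts, and the assembly of the cases\<close>

lemma (in field_tower) card_trace_sign_eq:
  assumes b: "b \<in> F"
  shows "2 * int (card {x \<in> K. ff_trace q t x = b \<and> quadratic_character K x = (- 1) ^ h})
    = int (q ^ (t - 1)) - (if b = 0 then 1 else 0) + (- 1) ^ h * char_sum b"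
proof -
  let ?T = "{x \<in> K. ff_trace q t x = b}"
  let ?\<chi> = "quadratic_character K"
  have fin: "finite ?T"
    by simp
  have "2 * int (card {x \<in> K. ff_trace q t x = b \<and> ?\<chi> x = (- 1) ^ h})
      = (\<Sum>x\<in>?T. if ?\<chi> x = (- 1) ^ h then 2 else 0)"
    by (simp add: sum.If_cases Int_def conj_assoc)
  \<comment> \<open>1 + (-1)^h \<chi>(x) is 2 or 0 for nonzero x but 1 at x = 0, which the extra -1
    cancels.\<close>
  also have "\<dots> = (\<Sum>x\<in>?T. (if x = 0 then - 1 else 0) + 1 + (- 1) ^ h * ?\<chi> x)"
  proof (rule sum.cong)
    fix x
    show "(if ?\<chi> x = (- 1) ^ h then 2 else 0) = (if x = 0 then - 1 else 0) + 1 + (- 1) ^ h * ?\<chi> x"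
      using quadratic_character_sign[of x K] by (cases "x = 0"; cases "even h") auto
  qed simp
  also have "\<dots> = (\<Sum>x\<in>?T. if x = 0 then - 1 else 0) + int (q ^ (t - 1)) + (- 1) ^ h * char_sum b"
    using card_trace_eq[OF b] by (simp add: sum.distrib char_sum_def sum_distrib_left)
  also have "(\<Sum>x\<in>?T. if x = 0 then - 1 else 0) = - (if b = 0 then 1 else 0 :: int)"
    using is_subfieldD(1)[OF subfield_K] by (subst sum.delta[OF fin]) auto
  finally show ?thesis
    by simp
qed

lemma (in field_tower) card_trace_nonzero_eq:
  assumes b: "b \<in> F"
  shows "int (card {x \<in> K. ff_trace q t x = b \<and> x \<noteq> 0})
    = int (q ^ (t - 1)) - (if b = 0 then 1 else 0)"
proof -
  let ?T = "{x \<in> K. ff_trace q t x = b}"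
  have "{x \<in> K. ff_trace q t x = b \<and> x \<noteq> 0} = ?T - {0}"
    by auto
  moreover have "0 \<in> ?T \<longleftrightarrow> b = 0"
    using is_subfieldD(1)[OF subfield_K] by auto
  moreover have "q ^ (t - 1) \<ge> 1"
    using q_ge_2 by simp
  ultimately show ?thesis
    using card_trace_eq[OF b]
    by (cases "b = 0") (simp_all only: card_Diff_singleton Diff_insert0 Diff_empty of_nat_diff
        simp_thms if_True if_False of_nat_1 diff_0_right)
qed

theorem theorem1:
  fixes p r q m t h d :: nat
    and \<gamma> g a :: "'a::finite_field"
    and Fq Ft :: "'a set"
    and \<rho> :: "'a \<Rightarrow> int"
    and N :: nat
  assumes "prime p" and "odd p" and "r \<ge> 1" and "q = p ^ r"
    and "m \<ge> 2" and "t dvd m"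
    and "CARD('a) = q ^ m"
    and "is_subfield Fq" and "card Fq = q"
    and "is_subfield Ft" and "card Ft = q ^ t"
    and "primitive_element \<gamma>" and "g = ff_norm q m \<gamma>"
    and "h \<in> {0, 1}" and "a \<in> Fq"
    and "\<not> p dvd m div t"
    and "d = gcd (m div t) 2" and "d dvd h"
    and "\<rho> = quadratic_character Fq"
    and "N = trace_norm_count q m Ft a g h"
  shows
    "(a = 0 \<longrightarrow>
       (odd (m div t) \<and> odd t \<longrightarrow>
          real N = 1 / 2 * (real q ^ (t - 1) - 1)) \<and>
       (odd (m div t) \<and> even t \<longrightarrow>
          real N = 1 / 2 * (real q ^ (t - 1) - 1
                     - (real q - 1) * (- 1) ^ h * real q ^ ((t - 2) div 2)
                         * real_of_int (\<rho> ((- 1) ^ (t div 2))))) \<and>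
       (even (m div t) \<longrightarrow>
          real N = real q ^ (t - 1) - 1)) \<and>
     (a \<noteq> 0 \<longrightarrow>
       (odd (m div t) \<and> odd t \<longrightarrow>
          real N = 1 / 2 * (real q ^ (t - 1)
                     + (- 1) ^ h * real q ^ ((t - 1) div 2)
                         * real_of_int (\<rho> ((- 1) ^ ((t - 1) div 2)
                                              * (of_nat (m div t) * inverse a))))) \<and>
       (odd (m div t) \<and> even t \<longrightarrow>
          real N = 1 / 2 * (real q ^ (t - 1)
                     + (- 1) ^ h * real q ^ ((t - 2) div 2)
                         * real_of_int (\<rho> ((- 1) ^ (t div 2))))) \<and>
       (even (m div t) \<longrightarrow>
          real N = real q ^ (t - 1)))"
proof -
  define s where "s = m div t"
  have m: "m = s * t"
    using assms(6) by (simp add: s_def)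
  have pos: "s > 0" "t > 0"
    using m assms(5) by (auto intro: Nat.gr0I)
  have odd_q: "odd q"
    using assms(2,4) by simp
  have CHAR: "CHAR('a) = p"
    using CHAR_eq_of_card[OF assms(1), of "r * m"] assms(4,7) by (simp add: power_mult)
  have "\<not> p dvd 2"
    using assms(1,2) primes_dvd_imp_eq[of p 2] by auto
  then have two: "(2::'a) \<noteq> 0"
    using of_nat_eq_0_iff_char_dvd[where 'a = 'a, of 2] CHAR by simp
  have s: "(of_nat s :: 'a) \<noteq> 0"
    using of_nat_eq_0_iff_char_dvd[where 'a = 'a, of s] CHAR assms(16) by (simp add: s_def)
  have q2: "q \<ge> 2"
    using subfield_card_ge_2[OF assms(8)] assms(9) by simp
  have card: "CARD('a) = (q ^ t) ^ s"
    using assms(7) m by (simp add: power_mult[symmetric] mult.commute)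
  obtain \<alpha> where \<alpha>: "\<alpha> \<in> Ft" "inj_on (\<lambda>i. \<alpha> ^ (q ^ i)) {..<t}"
    using subfield_generator[OF assms(12,10,11) card pos(1) q2] .
  interpret field_tower q t Fq Ft \<alpha>
    using assms(4,8-11) pos two odd_q CHAR \<alpha> by unfold_locales auto
  \<comment> \<open>On \<open>Ft\<close> the big trace is s times the trace to \<open>Fq\<close>,
    and s is invertible because p does not divide it.\<close>
  define b where "b = a * inverse (of_nat s)"
  have b: "b \<in> Fq" "b = 0 \<longleftrightarrow> a = 0"
    using assms(15) s is_subfield_intros(4,5)[OF assms(8)] is_subfield_of_nat[OF assms(8)]
    by (auto simp: b_def)
  have trace: "ff_trace q m x = a \<longleftrightarrow> ff_trace q t x = b" if "x \<in> Ft" for x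
    using ff_trace_mult[of x q t s] power_qt_K[of x] that s by (auto simp: m b_def field_simps)
  have char: "quadratic_character UNIV x = quadratic_character Ft x ^ s" if "x \<in> Ft" for x
    using quadratic_character_UNIV_eq[OF assms(10) two odd_card_K _ that] card card_K pos(1)
    by (cases "x = 0") auto
  have N: "N = card {x \<in> Ft. ff_trace q t x = b \<and> quadratic_character Ft x ^ s = (- 1) ^ h}"
    unfolding assms(20) trace_norm_count_def
    using ff_norm_in_coset_iff[OF assms(12,7) odd_q two assms(13,14)] assms(5) trace char
    by (intro arg_cong[where f = card]) auto
  have even_s: "real N = real q ^ (t - 1) - (if a = 0 then 1 else 0)" if "even s"
  proof -
    \<comment> \<open>For even s, d = 2 divides h. The s-th power of the character is then 1 at
      every nonzero x, so only x = 0 is excluded.\<close>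
    have "h = 0"
      using assms(14,17,18) that by (auto simp: s_def)
    then have "quadratic_character Ft x ^ s = (- 1) ^ h \<longleftrightarrow> x \<noteq> 0" for x
      using that pos(1) quadratic_character_sign[of x Ft] by (cases "x = 0") (auto simp: power_0_left)
    then have "int N = int (q ^ (t - 1)) - (if a = 0 then 1 else 0)"
      using card_trace_nonzero_eq[OF b(1)] N b(2) by simp
    then have "real_of_int (int N) = real_of_int (int (q ^ (t - 1)) - (if a = 0 then 1 else 0))"
      by (simp only:)
    then show ?thesis
      by simp
  qed
  have odd_s: "real N = 1 / 2 * (real q ^ (t - 1) - (if a = 0 then 1 else 0) + (- 1) ^ h * real_of_int (char_sum b))"
    if "odd s"
  proof -
    have "quadratic_character Ft x ^ s = quadratic_character Ft x" for x
      using that quadratic_character_sign[of x Ft] pos(1) by (cases "x = 0") auto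
    then have "2 * int N = int (q ^ (t - 1)) - (if a = 0 then 1 else 0) + (- 1) ^ h * char_sum b"
      using card_trace_sign_eq[OF b(1), of h] N b(2) by simp
    then have "real_of_int (2 * int N)
        = real_of_int (int (q ^ (t - 1)) - (if a = 0 then 1 else 0) + (- 1) ^ h * char_sum b)"
      by (simp only:)
    then show ?thesis
      by (cases "a = 0") simp_all
  qed
  \<comment> \<open>The character sum involves b = a / s, the statement its inverse s / a; the
    quadratic character does not distinguish an element from its inverse.\<close>
  have char_b: "quadratic_character Fq ((- 1) ^ k * (of_nat s * inverse a)) = quadratic_character Fq ((- 1) ^ k * b)"
    if "a \<noteq> 0" for k
  proof -
    have "(- 1) ^ k * b \<in> Fq" "(- 1) ^ k * b \<noteq> 0"
      using b that is_subfield_intros(2,4,6,9)[OF assms(8)] by auto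
    moreover have "inverse ((- 1) ^ k * b) = (- 1) ^ k * (of_nat s * inverse a)"
      by (simp add: b_def mult.commute power_inverse[symmetric])
    ultimately show ?thesis
      using quadratic_character_inverse[OF assms(8)] by metis
  qed
  have odd_odd: "real_of_int (char_sum b) = (if a = 0 then 0 else
      real q ^ ((t - 1) div 2) * real_of_int (\<rho> ((- 1) ^ ((t - 1) div 2) * (of_nat s * inverse a))))"
    if "odd t"
    using char_sum_odd[OF that b(1)] char_b b(2) by (simp add: assms(19))
  have odd_even: "real_of_int (char_sum b) = (if a = 0 then - (real q - 1) else 1)
      * real q ^ ((t - 2) div 2) * real_of_int (\<rho> ((- 1) ^ (t div 2)))"
    if "even t"
    using char_sum_even[OF that b(1)] b(2) by (simp add: assms(19))
  show ?thesis
    unfolding s_def[symmetric]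
    using even_s odd_s odd_odd odd_even by (cases "even s"; cases "even t"; cases "a = 0") (simp_all add: algebra_simps)
qed

end
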